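(* Let $k,n\ge1$ be integers and let $U_{n,k}$ be the sequence $(u_r)_{r\ge1}$ with $u_{1+i(k+1)}=1$ and $u_{j+i(k+1)}=n$ for all $i\ge0$ and $2\le j\le k+1$. Let $S=(s_i)_{i\ge1}$ with $s_i=1$ if $i\equiv1\bmod (kn+1)$ and $s_i=0$ otherwise. Suppose that the colors satisfy $c_{j+i(nk+1)}=c_j$ and $c_{\overline{j+i(nk+1)}}=c_{\overline j}$ for all $i\ge0$ and $1\le j\le nk+1$. Then \begin{align*} \sum_{\lambda\in \overline{\mathcal{P}}(U_{n,k})}C(\lambda)q^{|\lambda|_S}&= \frac{(-c_{\overline{1}}q;q)_\infty}{(c_{1}q;q)_\infty}\cdot \prod_{i=1}^k \frac{\prod_{j\geq 1} \overline{\mathcal{E}}_{n}(c_{\overline{2+(i-1)n}}q^{j},c_{2+(i-1)n}q^{j},\ldots,c_{\overline{in}}q^{j},c_{in}q^{j},c_{\overline{in+1}}q^{j},1)}{(c_{2+(i-1)n}q;q)_\infty \cdots (c_{1+in}q;q)_\infty},\\ \sum_{\lambda\in \mathcal{P}(U_{n,k})}C(\lambda)q^{|\lambda|_S}&= \frac{1}{(c_{1}q;q)_\infty}\cdot \prod_{i=1}^k \frac{\prod_{j\geq 1} \mathcal{E}_{n}(c_{2+(i-1)n}q^{j},\ldots,c_{in}q^{j})}{(c_{2+(i-1)n}q;q)_\infty \cdots (c_{1+in}q;q)_\infty}. \end{align*}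
   Context: Over-lined integers: $\overline{\mathbb{Z}_{\geq 1}}=\{\overline1,\overline2,\ldots\}$ is a disjoint copy of $\mathbb{Z}_{\ge 1}$; both $i$ and $\overline i$ have size $i$; arithmetic uses sizes. Order: $0<\overline1<1<\overline2<2<\cdots$. Let $\mathbb P$ be the set of infinite sequences $\lambda=(\lambda_i)_{i\ge1}$ in $\mathbb{Z}_{\geq 0}\sqcup\overline{\mathbb{Z}_{\geq 1}}$ with finitely many nonzero terms such that each $\overline i$ occurs at most once and, if it occurs, it comes after all occurrences of $i$ (sequences need not be monotone). For $\lambda\in\mathbb P$: $|\lambda|_S=\sum_{i\ge1}\lambda_i s_i$; the conjugate $\tilde\lambda=(\tilde\lambda_i)_{i\ge1}$ is given by: $\tilde\lambda_i$ has size $\#\{j\ge1:\lambda_j\ge\overline i\}$ and is over-lined iff $\overline i$ is a part of $\lambda$. The colors $c_1,\dots,c_{nk+1},c_{\overline 1},\dots,c_{\overline{nk+1}}$ are commuting indeterminates, extended periodically as stated, and $C(\lambda)=\prod_{0<\overline i\le M(\lambda)}c_{\tilde\lambda_i}$ where $M(\lambda)=\max_i\lambda_i$ (and $C(\lambda)=1$ for the zero sequence). For a sequence $U=(u_r)_{r\ge1}$ of positive integers with $U_r=u_1+\cdots+u_r$, $U_0=0$: $\overline{\mathcal P}(U)$ (block over-partitions of type $U$) is the set of $\lambda\in\mathbb P$ such that for all $r\ge1$, $\min\{\lambda_{U_{r-1}+1},\ldots,\lambda_{U_r}\}\ge\max\{\lambda_{U_r+1},\ldots,\lambda_{U_{r+1}}\}$;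 $\mathcal P(U)$ is the set of elements of $\overline{\mathcal P}(U)$ with no over-lined parts. With $\mathcal S_n$ the symmetric group and $\chi(A)=1$ if $A$ is true and $0$ otherwise, $$\overline{\mathcal E}_n(x_1,y_1,\ldots,x_n,y_n)=(y_n+x_n)\sum_{\sigma\in\mathcal S_n}\prod_{i=1}^{n-1}\bigl(y_i^{\chi(\sigma(i)>\sigma(i+1))}+x_i\bigr),\qquad \mathcal E_n(y_1,\ldots,y_{n-1})=\sum_{\sigma\in\mathcal S_n}\prod_{i=1}^{n-1}y_i^{\chi(\sigma(i)>\sigma(i+1))}.$$ $(a;q)_\infty=\prod_{k\ge0}(1-aq^k)$. Identities are between formal power series in $q$ and the colors. *)

theory Defs
  imports
    "HOL-Analysis.Analysis"
    "HOL-Combinatorics.Permutations"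
    "HOL-Computational_Algebra.Formal_Power_Series"
    "HOL-Library.Poly_Mapping"
    "HOL-Number_Theory.Cong"
begin

section \<open>Over-lined integers\<close>

text \<open>
  The type also contains the spurious element \<open>Over 0\<close>, which is not a legal part; it is
  excluded in \<open>parts_seqs\<close> below. In the order it lies just below \<open>Plain 0\<close>.
\<close>

datatype part = Plain nat | Over nat

fun part_size :: "part \<Rightarrow> nat" where
  "part_size (Plain i) = i"
| "part_size (Over i) = i"

fun overlined :: "part \<Rightarrow> bool" where
  "overlined (Plain i) = False"
| "overlined (Over i) = True"

text \<open>The order is \<open>Plain 0 < Over 1 < Plain 1 < Over 2 < Plain 2 < \<dots>\<close>\<close>

instantiation part :: linorder
begin

definition less_eq_part :: "part \<Rightarrow> part \<Rightarrow> bool" where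
  "a \<le> b \<longleftrightarrow> part_size a < part_size b \<or>
     part_size a = part_size b \<and> (overlined b \<longrightarrow> overlined a)"

definition less_part :: "part \<Rightarrow> part \<Rightarrow> bool" where
  "a < b \<longleftrightarrow> part_size a < part_size b \<or>
     part_size a = part_size b \<and> overlined a \<and> \<not> overlined b"

instance
proof
  fix a b :: part
  show "a \<le> b \<Longrightarrow> b \<le> a \<Longrightarrow> a = b"
    by (cases a; cases b) (auto simp: less_eq_part_def)
qed (auto simp: less_eq_part_def less_part_def)

end

section \<open>Sequences of parts\<close>

text \<open>
  A sequence $(\lambda_i)_{i \ge 1}$ is a function on \<open>nat\<close> whose irrelevant value at
  index 0 is fixed to be \<open>Plain 0\<close>, so that each sequence is represented exactly once.
\<close>

definition parts_seqs :: "(nat \<Rightarrow> part) set" where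
  "parts_seqs = {l. l 0 = Plain 0 \<and> (\<forall>i. l i \<noteq> Over 0) \<and> finite {i. l i \<noteq> Plain 0} \<and>
     (\<forall>i. \<forall>a\<ge>1. \<forall>b\<ge>1. l a = Over i \<and> l b = Over i \<longrightarrow> a = b) \<and>
     (\<forall>i. \<forall>a\<ge>1. \<forall>b\<ge>1. l a = Over i \<and> l b = Plain i \<longrightarrow> b < a)}"

definition partial_sums :: "(nat \<Rightarrow> nat) \<Rightarrow> nat \<Rightarrow> nat" where
  "partial_sums u r = (\<Sum>m=1..r. u m)"

text \<open>Here \<open>u\<close> is meant to take positive values at all indices \<open>r \<ge> 1\<close>.\<close>

definition block_overpartitions :: "(nat \<Rightarrow> nat) \<Rightarrow> (nat \<Rightarrow> part) set" where
  "block_overpartitions u = {l \<in> parts_seqs. \<forall>r\<ge>1.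
     Min (l ` {partial_sums u (r - 1) + 1..partial_sums u r})
       \<ge> Max (l ` {partial_sums u r + 1..partial_sums u (r + 1)})}"

definition block_partitions :: "(nat \<Rightarrow> nat) \<Rightarrow> (nat \<Rightarrow> part) set" where
  "block_partitions u = {l \<in> block_overpartitions u. \<forall>i\<ge>1. \<not> overlined (l i)}"

definition weight :: "(nat \<Rightarrow> nat) \<Rightarrow> (nat \<Rightarrow> part) \<Rightarrow> nat" where
  "weight s l = (\<Sum>i | i \<ge> 1 \<and> l i \<noteq> Plain 0. part_size (l i) * s i)"

definition conjugate :: "(nat \<Rightarrow> part) \<Rightarrow> nat \<Rightarrow> part" where
  "conjugate l i =
     (if \<exists>j\<ge>1. l j = Over i then Over else Plain) (card {j. j \<ge> 1 \<and> l j \<ge> Over i})"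

definition max_part :: "(nat \<Rightarrow> part) \<Rightarrow> part" where
  "max_part l = Max (l ` {1..})"

definition color_weight :: "(part \<Rightarrow> 'a::comm_monoid_mult) \<Rightarrow> (nat \<Rightarrow> part) \<Rightarrow> 'a" where
  "color_weight c l = (\<Prod>i | Plain 0 < Over i \<and> Over i \<le> max_part l. c (conjugate l i))"

section \<open>Power series\<close>

text \<open>
  Integer polynomials in indeterminates indexed by \<open>part\<close>, as finitely supported functions
  from monomials (exponent vectors) to coefficients. Formal power series in \<open>q\<close> over this
  ring carry the metric of \<open>HOL-Computational_Algebra.Formal_Power_Series\<close>, so infinite
  sums and products of them converge in the \<open>q\<close>-adic (coefficientwise) sense.
\<close>

type_synonym color_poly = "(part \<Rightarrow>\<^sub>0 nat) \<Rightarrow>\<^sub>0 int"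

definition indet :: "part \<Rightarrow> color_poly" where
  "indet v = Poly_Mapping.single (Poly_Mapping.single v 1) 1"

definition qpochhammer_inf :: "'a \<Rightarrow> 'a \<Rightarrow> 'a::{t2_space, comm_ring_1}" where
  "qpochhammer_inf a q = prodinf (\<lambda>k. 1 - a * q ^ k)"

text \<open>
  The coefficient ring is not a field, so the division of the library's power series is not
  available; all denominators have constant coefficient 1 and are inverted as follows.
\<close>

definition fps_recip :: "'a::comm_ring_1 fps \<Rightarrow> 'a fps" where
  "fps_recip f = fps_right_inverse f 1"

lemma fps_recip: "fps_nth f 0 = 1 \<Longrightarrow> f * fps_recip f = 1"
  unfolding fps_recip_def by (rule fps_right_inverse) simp

section \<open>Descent polynomials\<close>

text \<open>The arguments are $x_1, y_1, \dots, x_n, y_n$ and $y_1, \dots, y_{n-1}$ respectively.\<close>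

definition euler_over :: "nat \<Rightarrow> (nat \<Rightarrow> 'a) \<Rightarrow> (nat \<Rightarrow> 'a) \<Rightarrow> 'a::comm_semiring_1" where
  "euler_over n x y = (y n + x n) *
     (\<Sum>\<sigma> | \<sigma> permutes {1..n}. \<Prod>i=1..n-1. y i ^ of_bool (\<sigma> i > \<sigma> (i + 1)) + x i)"

definition euler_plain :: "nat \<Rightarrow> (nat \<Rightarrow> 'a) \<Rightarrow> 'a::comm_semiring_1" where
  "euler_plain n y =
     (\<Sum>\<sigma> | \<sigma> permutes {1..n}. \<Prod>i=1..n-1. y i ^ of_bool (\<sigma> i > \<sigma> (i + 1)))"

end

theory Submission
  imports Defs
begin

text \<open>
  Sorting a block overpartition stably, in decreasing order, by a permutation $\pi$ that preserves
  the blocks changes neither its colour weight nor its $q$-weight, because $S$ is constant on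
  blocks. It yields a weakly decreasing overpartition $\mu$, and the pairs $(\pi, \mu)$ that arise
  are exactly those in which the size of $\mu$ drops strictly at every descent of $\pi$. Such a
  $\mu$ is determined by its independent steps $\mu_t - \mu_{t+1}$, each with an optional overline.
  Position $t$, with $h$ indices $i \le t$ for which $s_i = 1$, contributes
  $(c_t q^h + c_{\bar t} q^h)/(1 - c_t q^h)$ if it is a descent and
  $(1 + c_{\bar t} q^h)/(1 - c_t q^h)$ otherwise. The sum over $\pi$ factors into one descent
  polynomial per block.
\<close>

text \<open>The descent condition sees sizes only, because \<open>Over i\<close> is the least part
  of size \<open>i\<close>: decreasing order puts it after its plain copies, and
  \<open>parts_seqs\<close> asks the same of their positions. So stable sorting keeps all entries of
  one size in their original order, overlined or not. Conversely, if \<open>\<pi>\<close> increases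
  along each run of equal size, undoing the sort leaves \<open>Over i\<close> after its plain
  copies. S is constant on blocks because the positions with s_i = 1 are exactly the blocks of
  length one of the sequence U. The obstacle is infinity: sorting and the sum over
  \<open>\<pi>\<close> need finitely many positions. The blocks are cut after J periods ("rows") of
  k n + 1 positions. A sequence reaching further is nonzero at the start of each of the first J
  rows, so its weight is at least J; later rows change the product side only from q^J on. Hence the
  truncation is exact modulo q^J on both sides. The second identity is the first with the overlined
  colors set to 0, which kills every summand that has an overlined part.\<close>

unbundle fps_syntax

section \<open>Congruences and summation modulo powers of the variable\<close>

text \<open>Congruence modulo \<open>fps_X ^ m\<close> is written as divisibility of a difference,
  so that ring algebra carries it through sums, products and reciprocals; this lemma and the next
  are the bridge back to coefficients.\<close>

lemma fps_X_power_dvd_iff: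
  fixes f :: "'a::comm_ring_1 fps"
  shows "fps_X ^ m dvd f \<longleftrightarrow> (\<forall>i<m. f $ i = 0)"
proof
  assume "fps_X ^ m dvd f"
  then show "\<forall>i<m. f $ i = 0"
    by (auto simp: dvd_def fps_X_power_mult_nth)
next
  assume "\<forall>i<m. f $ i = 0"
  then have "f = fps_X ^ m * fps_shift m f"
    by (auto simp: fps_eq_iff fps_X_power_mult_nth)
  then show "fps_X ^ m dvd f"
    by (metis dvd_triv_left)
qed

lemma fps_X_power_dvd_diff_iff:
  fixes f g :: "'a::comm_ring_1 fps"
  shows "fps_X ^ m dvd f - g \<longleftrightarrow> (\<forall>i<m. f $ i = g $ i)"
  by (simp add: fps_X_power_dvd_iff)

lemma dvd_diff_trans:
  fixes a b c d :: "'a::comm_ring_1"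
  shows "d dvd a - b \<Longrightarrow> d dvd b - c \<Longrightarrow> d dvd a - c"
  by (metis diff_add_cancel add_diff_eq dvd_add)

lemma dvd_diff_mult:
  fixes a b a' b' d :: "'a::comm_ring_1"
  assumes "d dvd a - a'" "d dvd b - b'"
  shows "d dvd a * b - a' * b'"
proof -
  have "a * b - a' * b' = (a - a') * b + a' * (b - b')"
    by (simp add: algebra_simps)
  then show ?thesis
    using assms by (simp add: dvd_mult dvd_mult2)
qed

lemma dvd_diff_prod:
  fixes f g :: "'b \<Rightarrow> 'a::comm_ring_1"
  shows "(\<And>i. i \<in> I \<Longrightarrow> d dvd f i - g i) \<Longrightarrow> d dvd prod f I - prod g I"
  by (induction I rule: infinite_finite_induct) (auto intro: dvd_diff_mult)

section \<open>Reciprocals of series with constant coefficient 1\<close>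

lemma fps_recip_unique:
  fixes f g :: "'a::comm_ring_1 fps"
  assumes "f $ 0 = 1" "f * g = 1"
  shows "fps_recip f = g"
proof -
  have "fps_recip f = fps_recip f * (f * g)"
    by (simp add: assms)
  also have "\<dots> = (f * fps_recip f) * g"
    by (simp add: mult_ac)
  finally show ?thesis
    by (simp add: fps_recip assms)
qed

lemma fps_recip_mult:
  fixes f g :: "'a::comm_ring_1 fps"
  assumes "f $ 0 = 1" "g $ 0 = 1"
  shows "fps_recip (f * g) = fps_recip f * fps_recip g"
proof (rule fps_recip_unique)
  have "f * g * (fps_recip f * fps_recip g) = (f * fps_recip f) * (g * fps_recip g)"
    by (simp add: mult_ac)
  then show "f * g * (fps_recip f * fps_recip g) = 1"
    by (simp add: fps_recip assms)
qed (simp add: assms)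

lemma fps_prod_nth_0_eq_1:
  fixes f :: "'b \<Rightarrow> 'a::comm_ring_1 fps"
  shows "(\<And>i. i \<in> I \<Longrightarrow> f i $ 0 = 1) \<Longrightarrow> prod f I $ 0 = 1"
  by (induction I rule: infinite_finite_induct) auto

lemma fps_recip_one [simp]: "fps_recip (1 :: 'a::comm_ring_1 fps) = 1"
  by (rule fps_recip_unique) auto

lemma fps_recip_prod:
  fixes f :: "'b \<Rightarrow> 'a::comm_ring_1 fps"
  shows "(\<And>i. i \<in> I \<Longrightarrow> f i $ 0 = 1) \<Longrightarrow> fps_recip (prod f I) = (\<Prod>i\<in>I. fps_recip (f i))"
  by (induction I rule: infinite_finite_induct) (auto simp: fps_recip_mult fps_prod_nth_0_eq_1)

text \<open>In fractions, 1/f - 1/g = (f - g) * (-1/(f g)). The inserted factors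
  \<open>g * fps_recip g\<close> and \<open>f * fps_recip f\<close> equal 1 and supply the common
  denominator.\<close>

lemma dvd_diff_fps_recip:
  fixes f g :: "'a::comm_ring_1 fps"
  assumes "f $ 0 = 1" "g $ 0 = 1" "d dvd f - g"
  shows "d dvd fps_recip f - fps_recip g"
proof -
  have "fps_recip f - fps_recip g
      = fps_recip f * (g * fps_recip g) - fps_recip g * (f * fps_recip f)"
    by (simp add: fps_recip assms)
  also have "\<dots> = (f - g) * (- fps_recip f * fps_recip g)"
    by (simp add: algebra_simps)
  finally show ?thesis
    using assms(3) by simp
qed

text \<open>Multiplication by \<open>P j\<close> changes no coefficient up to index
  \<open>j\<close>, so coefficient \<open>m\<close> of the partial products is frozen from index
  \<open>m\<close> on. The limit is the diagonal series of these frozen coefficients.\<close>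

lemma prodinf_fps_X_adic:
  fixes P :: "nat \<Rightarrow> 'a::comm_ring_1 fps"
  assumes P: "\<And>j. fps_X ^ Suc j dvd P j - 1"
  shows "fps_X ^ J dvd prodinf P - (\<Prod>j<J. P j)"
proof -
  define Q where "Q n = (\<Prod>j\<le>n. P j)" for n
  have step: "Q n $ m = Q m $ m" if "m \<le> n" for m n
    using that
  proof (induction n rule: dec_induct)
    case (step n)
    have "Q (Suc n) - Q n = (P (Suc n) - 1) * Q n"
      by (simp add: Q_def algebra_simps)
    then have "fps_X ^ Suc (Suc n) dvd Q (Suc n) - Q n"
      by (simp only:) (intro dvd_mult2 P)
    then have "Q (Suc n) $ m = Q n $ m"
      unfolding fps_X_power_dvd_diff_iff using step by auto
    then show ?case
      using step by simp
  qed simp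
  define L where "L = Abs_fps (\<lambda>m. Q m $ m)"
  have "Q \<longlonglongrightarrow> L"
  proof (rule tendsto_fpsI)
    fix m
    show "\<forall>\<^sub>F n in sequentially. Q n $ m = L $ m"
      using eventually_ge_at_top[of m] by eventually_elim (auto simp: L_def intro: step)
  qed
  moreover have "L $ 0 = 1"
  proof -
    have "fps_X ^ 1 dvd P 0 - 1"
      using P[of 0] by simp
    then show ?thesis
      unfolding fps_X_power_dvd_diff_iff by (simp add: L_def Q_def)
  qed
  then have "L \<noteq> 0"
    by auto
  ultimately have "raw_has_prod P 0 L"
    by (simp add: raw_has_prod_def Q_def[abs_def])
  then have "P has_prod L"
    by (simp add: has_prod_def)
  \<comment> \<open>\<open>has_prod\<close> also assigns the value 0 when a factor vanishes.
    Excluding this leaves \<open>L\<close> as the only value, as the definite description in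
    \<open>prodinf\<close> requires.\<close>
  have "P j \<noteq> 0" for j
  proof
    assume "P j = 0"
    then have "fps_X ^ Suc j dvd 0 - (1 :: 'a fps)"
      using P[of j] by simp
    then show False
      unfolding fps_X_power_dvd_diff_iff by auto
  qed
  then have "p = L" if "P has_prod p" for p
    using that \<open>raw_has_prod P 0 L\<close> LIMSEQ_unique
    by (auto simp: has_prod_def raw_has_prod_def)
  with \<open>P has_prod L\<close> have "prodinf P = L"
    unfolding prodinf_def by blast
  moreover have "fps_X ^ J dvd L - (\<Prod>j<J. P j)"
    unfolding fps_X_power_dvd_diff_iff
  proof safe
    fix i assume "i < J"
    then obtain n where "J = Suc n" "i \<le> n"
      by (cases J) auto
    then show "L $ i = (\<Prod>j<J. P j) $ i"
      using step[of i n] by (simp add: L_def Q_def lessThan_Suc_atMost)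
  qed
  ultimately show ?thesis
    by simp
qed

lemma prodinf_fps_nth_0:
  fixes P :: "nat \<Rightarrow> 'a::comm_ring_1 fps"
  assumes P: "\<And>j. fps_X ^ Suc j dvd P j - 1"
  shows "prodinf P $ 0 = 1"
proof -
  have "prodinf P $ 0 = (\<Prod>j<1. P j) $ 0"
    using prodinf_fps_X_adic[of P 1, OF P] unfolding fps_X_power_dvd_diff_iff by blast
  also have "\<dots> = 1"
    using P[of 0] unfolding fps_X_power_dvd_diff_iff by simp
  finally show ?thesis .
qed

text \<open>
  Implies \<open>has_sum\<close> and, unlike it, is compatible with products without topological assumptions
  on the coefficient ring.
\<close>

definition adic_sum :: "('b \<Rightarrow> 'a::comm_ring_1 fps) \<Rightarrow> 'b set \<Rightarrow> 'a fps \<Rightarrow> bool" where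
  "adic_sum f A S \<longleftrightarrow> (\<forall>m. \<exists>B\<subseteq>A. finite B \<and>
     (\<forall>a\<in>A - B. fps_X ^ m dvd f a) \<and> fps_X ^ m dvd S - sum f B)"

lemma adic_sumE:
  assumes "adic_sum f A S"
  obtains B where "B \<subseteq> A" "finite B" "\<forall>a\<in>A - B. fps_X ^ m dvd f a"
    "fps_X ^ m dvd S - sum f B"
proof -
  from assms have "\<exists>B\<subseteq>A. finite B \<and> (\<forall>a\<in>A - B. fps_X ^ m dvd f a) \<and> fps_X ^ m dvd S - sum f B"
    unfolding adic_sum_def ..
  then show ?thesis
    using that by (elim exE conjE) simp
qed

lemma adic_sum_imp_has_sum:
  assumes "adic_sum f A S"
  shows "(f has_sum S) A"
  unfolding has_sum_def
proof (rule tendsto_fpsI)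
  fix n
  obtain B where B: "B \<subseteq> A" "finite B" "\<forall>a\<in>A - B. fps_X ^ Suc n dvd f a"
    "fps_X ^ Suc n dvd S - sum f B"
    using assms by (rule adic_sumE[where m = "Suc n"])
  have "sum f Y $ n = S $ n" if Y: "finite Y" "B \<subseteq> Y" "Y \<subseteq> A" for Y
  proof -
    have "fps_X ^ Suc n dvd S - sum f B - sum f (Y - B)"
      using B(3) Y(3) by (intro dvd_diff[OF B(4)] dvd_sum) auto
    also have "S - sum f B - sum f (Y - B) = S - sum f Y"
      using Y B by (simp add: sum_diff)
    finally have "\<forall>i<Suc n. S $ i = sum f Y $ i"
      unfolding fps_X_power_dvd_diff_iff .
    then show ?thesis by simp
  qed
  then show "\<forall>\<^sub>F Y in finite_subsets_at_top A. sum f Y $ n = S $ n"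
    unfolding eventually_finite_subsets_at_top using B by blast
qed

lemma adic_sum_reindex:
  assumes "bij_betw h A B" "adic_sum f A S" "\<And>a. a \<in> A \<Longrightarrow> g (h a) = f a"
  shows "adic_sum g B S"
  unfolding adic_sum_def
proof
  fix m
  obtain A' where A': "A' \<subseteq> A" "finite A'" "\<forall>a\<in>A - A'. fps_X ^ m dvd f a"
    "fps_X ^ m dvd S - sum f A'"
    using assms(2) by (rule adic_sumE[where m = m])
  have inj: "inj_on h A" and img: "h ` A = B"
    using assms(1) by (auto simp: bij_betw_def)
  have "sum g (h ` A') = sum f A'"
    using A' assms(3) inj by (subst sum.reindex) (auto intro: inj_on_subset sum.cong)
  moreover have "fps_X ^ m dvd g b" if "b \<in> B - h ` A'" for b
    using that img A'(1,3) assms(3) by auto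
  ultimately show "\<exists>B'\<subseteq>B. finite B' \<and> (\<forall>b\<in>B - B'. fps_X ^ m dvd g b) \<and> fps_X ^ m dvd S - sum g B'"
    using A' img by (intro exI[of _ "h ` A'"]) auto
qed

lemma adic_sum_singleton: "adic_sum f {a} (f a)"
  unfolding adic_sum_def by (auto intro!: exI[of _ "{a}"])

lemma adic_sum_Sigma:
  assumes "finite I" "\<And>i. i \<in> I \<Longrightarrow> adic_sum (\<lambda>a. f (i, a)) (A i) (S i)"
  shows "adic_sum f (Sigma I A) (sum S I)"
  unfolding adic_sum_def
proof
  fix m
  have "\<exists>B. B \<subseteq> A i \<and> finite B \<and> (\<forall>a\<in>A i - B. fps_X ^ m dvd f (i, a)) \<and>
      fps_X ^ m dvd S i - (\<Sum>a\<in>B. f (i, a))" if "i \<in> I" for i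
    using assms(2)[OF that] unfolding adic_sum_def by simp
  then obtain B where B: "\<And>i. i \<in> I \<Longrightarrow> B i \<subseteq> A i" "\<And>i. i \<in> I \<Longrightarrow> finite (B i)"
    "\<And>i a. i \<in> I \<Longrightarrow> a \<in> A i - B i \<Longrightarrow> fps_X ^ m dvd f (i, a)"
    "\<And>i. i \<in> I \<Longrightarrow> fps_X ^ m dvd S i - (\<Sum>a\<in>B i. f (i, a))"
    by metis
  have "sum f (Sigma I B) = (\<Sum>i\<in>I. \<Sum>a\<in>B i. f (i, a))"
    using assms(1) B(2) by (subst sum.Sigma) auto
  then have "sum S I - sum f (Sigma I B) = (\<Sum>i\<in>I. S i - (\<Sum>a\<in>B i. f (i, a)))"
    by (simp add: sum_subtractf)
  then have "fps_X ^ m dvd sum S I - sum f (Sigma I B)"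
    using B(4) by (auto intro: dvd_sum)
  moreover have "fps_X ^ m dvd f p" if "p \<in> Sigma I A - Sigma I B" for p
  proof (cases p)
    case (Pair i a)
    with that have "i \<in> I" "a \<in> A i - B i"
      by auto
    then show ?thesis
      using B(3) Pair by simp
  qed
  ultimately show "\<exists>B'\<subseteq>Sigma I A. finite B' \<and> (\<forall>p\<in>Sigma I A - B'. fps_X ^ m dvd f p) \<and>
      fps_X ^ m dvd sum S I - sum f B'"
    using assms(1) B(1,2) by (intro exI[of _ "Sigma I B"]) auto
qed

lemma adic_sum_union:
  assumes "adic_sum f A S" "adic_sum f B T" "A \<inter> B = {}"
  shows "adic_sum f (A \<union> B) (S + T)"
  unfolding adic_sum_def
proof
  fix m
  obtain A' where A': "A' \<subseteq> A" "finite A'" "\<forall>a\<in>A - A'. fps_X ^ m dvd f a"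
    "fps_X ^ m dvd S - sum f A'"
    using assms(1) by (rule adic_sumE[where m = m])
  obtain B' where B': "B' \<subseteq> B" "finite B'" "\<forall>a\<in>B - B'. fps_X ^ m dvd f a"
    "fps_X ^ m dvd T - sum f B'"
    using assms(2) by (rule adic_sumE[where m = m])
  have "sum f (A' \<union> B') = sum f A' + sum f B'"
    using A' B' assms(3) by (intro sum.union_disjoint) auto
  then have "S + T - sum f (A' \<union> B') = (S - sum f A') + (T - sum f B')"
    by simp
  then have "fps_X ^ m dvd S + T - sum f (A' \<union> B')"
    using A' B' by (metis dvd_add)
  then show "\<exists>D\<subseteq>A \<union> B. finite D \<and> (\<forall>a\<in>A \<union> B - D. fps_X ^ m dvd f a) \<and>
      fps_X ^ m dvd S + T - sum f D"
    using A' B' by (intro exI[of _ "A' \<union> B'"]) blast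
qed

lemma adic_sum_times:
  assumes "adic_sum f A S" "adic_sum g B T"
  shows "adic_sum (\<lambda>(a, b). f a * g b) (A \<times> B) (S * T)"
  unfolding adic_sum_def
proof
  fix m
  obtain A' where A': "A' \<subseteq> A" "finite A'" "\<forall>a\<in>A - A'. fps_X ^ m dvd f a"
    "fps_X ^ m dvd S - sum f A'"
    using assms(1) by (rule adic_sumE[where m = m])
  obtain B' where B': "B' \<subseteq> B" "finite B'" "\<forall>a\<in>B - B'. fps_X ^ m dvd g a"
    "fps_X ^ m dvd T - sum g B'"
    using assms(2) by (rule adic_sumE[where m = m])
  have "(\<Sum>(a, b)\<in>A' \<times> B'. f a * g b) = sum f A' * sum g B'"
    by (simp add: sum_product sum.cartesian_product)
  moreover have "fps_X ^ m dvd S * T - sum f A' * sum g B'"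
    using A' B' by (intro dvd_diff_mult)
  moreover have "\<forall>p\<in>A \<times> B - A' \<times> B'. fps_X ^ m dvd (case p of (a, b) \<Rightarrow> f a * g b)"
    using A'(3) B'(3) by (auto intro: dvd_mult dvd_mult2)
  ultimately show "\<exists>D\<subseteq>A \<times> B. finite D \<and>
      (\<forall>p\<in>A \<times> B - D. fps_X ^ m dvd (case p of (a, b) \<Rightarrow> f a * g b)) \<and>
      fps_X ^ m dvd S * T - (\<Sum>(a, b)\<in>D. f a * g b)"
    using A' B' by (intro exI[of _ "A' \<times> B'"]) auto
qed

lemma adic_sum_cmult:
  assumes "adic_sum f A S"
  shows "adic_sum (\<lambda>a. c * f a) A (c * S)"
  using adic_sum_times[OF adic_sum_singleton[of "\<lambda>_. c" "()"] assms]
  by (rule adic_sum_reindex[of snd, rotated]) (auto simp: bij_betw_def inj_on_def)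

text \<open>\<open>T\<close> may vary with \<open>m\<close>: it suffices to sum exactly over a
  subset that catches every term visible modulo \<open>fps_X ^ m\<close>. The main sum arises this
  way, with \<open>B\<close> the sequences supported on the first \<open>m\<close> rows.\<close>

lemma adic_sum_approx:
  assumes "\<And>m. \<exists>B\<subseteq>A. \<exists>T. adic_sum f B T \<and> fps_X ^ m dvd S - T \<and>
    (\<forall>a\<in>A - B. fps_X ^ m dvd f a)"
  shows "adic_sum f A S"
  unfolding adic_sum_def
proof
  fix m
  obtain B T where B: "B \<subseteq> A" "adic_sum f B T" "fps_X ^ m dvd S - T"
    "\<forall>a\<in>A - B. fps_X ^ m dvd f a"
    using assms[of m] by blast
  obtain B' where B': "B' \<subseteq> B" "finite B'" "\<forall>a\<in>B - B'. fps_X ^ m dvd f a"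
    "fps_X ^ m dvd T - sum f B'"
    using B(2) by (rule adic_sumE[where m = m])
  have "fps_X ^ m dvd S - sum f B'"
    using B(3) B'(4) by (rule dvd_diff_trans)
  then show "\<exists>B\<subseteq>A. finite B \<and> (\<forall>a\<in>A - B. fps_X ^ m dvd f a) \<and> fps_X ^ m dvd S - sum f B"
    using B B' by (intro exI[of _ B']) blast
qed

text \<open>Expansion of a finite product of sums, one coordinate at a time. The fixed value
  \<open>z\<close> outside \<open>I\<close> makes each choice function a single object, so that
  overwriting coordinate \<open>j\<close> is a bijection, inverted by resetting it to
  \<open>z\<close>.\<close>

lemma adic_sum_functions:
  assumes "finite I" "\<And>i. i \<in> I \<Longrightarrow> adic_sum (f i) (A i) (S i)"
  shows "adic_sum (\<lambda>g. \<Prod>i\<in>I. f i (g i))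
    {g. (\<forall>i\<in>I. g i \<in> A i) \<and> (\<forall>i. i \<notin> I \<longrightarrow> g i = z)} (\<Prod>i\<in>I. S i)"
  using assms
proof (induction I)
  case empty
  have "{g. (\<forall>i\<in>{}. g i \<in> A i) \<and> (\<forall>i. i \<notin> {} \<longrightarrow> g i = z)} = {\<lambda>_. z}"
    by auto
  then show ?case
    using adic_sum_singleton[of "\<lambda>_. 1" "\<lambda>_. z"] by simp
next
  case (insert j I)
  let ?F = "\<lambda>I. {g. (\<forall>i\<in>I. g i \<in> A i) \<and> (\<forall>i. i \<notin> I \<longrightarrow> g i = z)}"
  have "adic_sum (\<lambda>(a, g). f j a * (\<Prod>i\<in>I. f i (g i))) (A j \<times> ?F I) (S j * (\<Prod>i\<in>I. S i))"
    using insert by (intro adic_sum_times) auto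
  moreover have "bij_betw (\<lambda>(a, g). g(j := a)) (A j \<times> ?F I) (?F (insert j I))"
    using insert(2) by (intro bij_betw_byWitness[of _ "\<lambda>g. (g j, g(j := z))"]) auto
  moreover have "(\<Prod>i\<in>insert j I. f i ((g(j := a)) i)) = f j a * (\<Prod>i\<in>I. f i (g i))" for a g
  proof -
    have "(\<Prod>i\<in>I. f i ((g(j := a)) i)) = (\<Prod>i\<in>I. f i (g i))"
      using insert(2) by (intro prod.cong) auto
    then show ?thesis
      using insert(1,2) by simp
  qed
  ultimately show ?case
    using insert(1,2)
    by (auto intro: adic_sum_reindex[where h = "\<lambda>(a, g). g(j := a)"])
qed

lemma adic_sum_geometric:
  fixes y :: "'a::comm_ring_1 fps"
  assumes "fps_X dvd y"
  shows "adic_sum (\<lambda>d. y ^ d) UNIV (fps_recip (1 - y))"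
  unfolding adic_sum_def
proof
  fix m
  have y0: "(1 - y) $ 0 = 1"
    using assms fps_X_power_dvd_iff[of 1 y] by simp
  have dvd: "fps_X ^ m dvd y ^ d" if "m \<le> d" for d
    using assms that by (meson dvd_power_same dvd_trans le_imp_power_dvd)
  have "1 - y ^ m = (1 - y) * (\<Sum>d<m. y ^ d)"
    by (rule one_diff_power_eq)
  then have "fps_recip (1 - y) * (1 - y ^ m) = ((1 - y) * fps_recip (1 - y)) * (\<Sum>d<m. y ^ d)"
    by (simp only: mult_ac)
  then have "fps_recip (1 - y) - (\<Sum>d<m. y ^ d) = fps_recip (1 - y) * y ^ m"
    by (simp only: fps_recip[OF y0]) (simp add: algebra_simps)
  then have "fps_X ^ m dvd fps_recip (1 - y) - (\<Sum>d<m. y ^ d)"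
    using dvd[of m] by simp
  then show "\<exists>B\<subseteq>UNIV. finite B \<and> (\<forall>d\<in>UNIV - B. fps_X ^ m dvd y ^ d) \<and>
      fps_X ^ m dvd fps_recip (1 - y) - (\<Sum>d\<in>B. y ^ d)"
    using dvd by (intro exI[of _ "{..<m}"]) auto
qed

section \<open>Overpartitions and their steps\<close>

lemma less_eq_part_imp_size: "(a :: part) \<le> b \<Longrightarrow> part_size a \<le> part_size b"
  by (auto simp: less_eq_part_def)

lemma Over_le_iff: "Over i \<le> p \<longleftrightarrow> i \<le> part_size p"
  by (auto simp: less_eq_part_def)

lemma Plain_0_le: "p \<noteq> Over 0 \<Longrightarrow> Plain 0 \<le> p"
  by (cases p) (auto simp: less_eq_part_def)

definition mk_part :: "bool \<Rightarrow> nat \<Rightarrow> part" where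
  "mk_part b d = (if b then Over d else Plain d)"

lemma part_size_mk_part [simp]: "part_size (mk_part b d) = d"
  by (simp add: mk_part_def)

lemma overlined_mk_part [simp]: "overlined (mk_part b d) = b"
  by (simp add: mk_part_def)

lemma mk_part_collapse [simp]: "mk_part (overlined p) (part_size p) = p"
  by (cases p) (auto simp: mk_part_def)

lemma part_eqI: "part_size p = part_size p' \<Longrightarrow> overlined p = overlined p' \<Longrightarrow> p = p'"
  by (cases p; cases p') auto

lemma mk_part_eq_Over_iff [simp]: "mk_part b d = Over i \<longleftrightarrow> b \<and> d = i"
  by (auto simp: mk_part_def)

lemma mk_part_eq_Plain_iff [simp]: "mk_part b d = Plain i \<longleftrightarrow> \<not> b \<and> d = i"
  by (auto simp: mk_part_def)

definition overpartitions :: "nat \<Rightarrow> (nat \<Rightarrow> part) set" where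
  "overpartitions L =
     {l \<in> parts_seqs. (\<forall>s\<ge>1. \<forall>t\<ge>s. l t \<le> l s) \<and> (\<forall>t>L. l t = Plain 0)}"

lemma parts_seqsD:
  assumes "l \<in> parts_seqs"
  shows "l 0 = Plain 0" "l i \<noteq> Over 0" "finite {i. l i \<noteq> Plain 0}"
    "\<lbrakk>a \<ge> 1; b \<ge> 1; l a = Over i; l b = Over i\<rbrakk> \<Longrightarrow> a = b"
    "\<lbrakk>a \<ge> 1; b \<ge> 1; l a = Over i; l b = Plain i\<rbrakk> \<Longrightarrow> b < a"
  using assms unfolding parts_seqs_def by auto

lemma overpartitionsD:
  assumes "l \<in> overpartitions L"
  shows "l \<in> parts_seqs" "s \<ge> 1 \<Longrightarrow> s \<le> t \<Longrightarrow> l t \<le> l s" "t > L \<Longrightarrow> l t = Plain 0"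
    "s \<ge> 1 \<Longrightarrow> s \<le> t \<Longrightarrow> part_size (l t) \<le> part_size (l s)"
  using assms unfolding overpartitions_def by (auto intro: less_eq_part_imp_size)

text \<open>No part of size \<open>i\<close> lies below \<open>Over i\<close>, so a successor of the
  same size would be a second \<open>Over i\<close>.\<close>

lemma overpartitions_overlined_step:
  assumes l: "l \<in> overpartitions L" and t: "t \<ge> 1" "overlined (l t)"
  shows "part_size (l (Suc t)) < part_size (l t)"
proof (rule ccontr)
  assume not_less: "\<not> part_size (l (Suc t)) < part_size (l t)"
  obtain i where i: "l t = Over i"
    using t by (cases "l t") auto
  have "l (Suc t) \<le> l t"
    using overpartitionsD(2)[OF l, of t "Suc t"] t by simp
  with not_less i have "l (Suc t) = Over i"
    by (intro part_eqI) (auto simp: less_eq_part_def)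
  then have "t = Suc t"
    using parts_seqsD(4)[OF overpartitionsD(1)[OF l]] t i by (meson le_SucI)
  then show False by simp
qed

text \<open>Coordinates of a decreasing sequence: \<open>e t\<close> joins the drop in size after
  position \<open>t\<close> with the overline of position \<open>t\<close>. They are independent of
  each other; the only illegal value is \<open>Over 0\<close>, since an overline forces a strict
  drop.\<close>

definition step_set :: "nat \<Rightarrow> (nat \<Rightarrow> part) set" where
  "step_set L = {e. (\<forall>t\<in>{1..L}. e t \<noteq> Over 0) \<and> (\<forall>t. t \<notin> {1..L} \<longrightarrow> e t = Plain 0)}"

definition from_steps :: "nat \<Rightarrow> (nat \<Rightarrow> part) \<Rightarrow> nat \<Rightarrow> part" where
  "from_steps L e t =
     (if t = 0 then Plain 0 else mk_part (overlined (e t)) (\<Sum>r=t..L. part_size (e r)))"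

definition steps :: "(nat \<Rightarrow> part) \<Rightarrow> nat \<Rightarrow> part" where
  "steps l t = (if t = 0 then Plain 0
     else mk_part (overlined (l t)) (part_size (l t) - part_size (l (Suc t))))"

lemma step_setD:
  assumes "e \<in> step_set L"
  shows "e t \<noteq> Over 0" "t \<notin> {1..L} \<Longrightarrow> e t = Plain 0" "overlined (e t) \<Longrightarrow> t \<in> {1..L}"
    "overlined (e t) \<Longrightarrow> part_size (e t) > 0"
proof -
  show nz: "e t \<noteq> Over 0"
    using assms unfolding step_set_def by (cases "t \<in> {1..L}") auto
  show out: "t \<notin> {1..L} \<Longrightarrow> e t = Plain 0"
    using assms unfolding step_set_def by auto
  show "overlined (e t) \<Longrightarrow> t \<in> {1..L}"
    using out by force
  show "overlined (e t) \<Longrightarrow> part_size (e t) > 0"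
    using nz by (cases "e t") auto
qed

lemma from_steps_size:
  assumes "e \<in> step_set L" "t \<ge> 1"
  shows "part_size (from_steps L e t) = part_size (e t) + part_size (from_steps L e (Suc t))"
proof (cases "t \<le> L")
  case True
  then have "{t..L} = insert t {Suc t..L}"
    by auto
  then show ?thesis
    using assms by (simp add: from_steps_def)
next
  case False
  then show ?thesis
    using assms step_setD(2)[OF assms(1), of t] by (simp add: from_steps_def)
qed

lemma from_steps_size_mono:
  assumes "1 \<le> s" "s \<le> t"
  shows "part_size (from_steps L e t) \<le> part_size (from_steps L e s)"
  using assms by (auto simp: from_steps_def intro!: sum_mono2)

lemma from_steps_size_less:
  assumes e: "e \<in> step_set L" and "1 \<le> s" "s < t" "overlined (e s)"
  shows "part_size (from_steps L e t) < part_size (from_steps L e s)"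
proof -
  have "part_size (from_steps L e t) \<le> part_size (from_steps L e (Suc s))"
    using assms by (intro from_steps_size_mono) auto
  also have "\<dots> < part_size (from_steps L e s)"
    using from_steps_size[OF e, of s] step_setD(4)[OF e] assms by simp
  finally show ?thesis .
qed

lemma from_steps_overlined: "t \<ge> 1 \<Longrightarrow> overlined (from_steps L e t) = overlined (e t)"
  by (simp add: from_steps_def)

lemma from_steps_in_overpartitions:
  assumes e: "e \<in> step_set L"
  shows "from_steps L e \<in> overpartitions L"
proof -
  let ?l = "from_steps L e"
  have out: "?l t = Plain 0" if "t > L" for t
    using that step_setD(2)[OF e, of t] by (simp add: from_steps_def)
  have nz: "?l t \<noteq> Over 0" for t
  proof
    assume *: "?l t = Over 0"
    then have t: "t \<ge> 1"
      by (cases t) (auto simp: from_steps_def)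
    then show False
      using * from_steps_size[OF e t] step_setD(4)[OF e, of t] from_steps_overlined[OF t, of L e]
      by simp
  qed
  have fin: "finite {i. ?l i \<noteq> Plain 0}"
  proof (rule finite_subset)
    show "{i. ?l i \<noteq> Plain 0} \<subseteq> {..L}"
      using out not_le by auto
  qed simp
  \<comment> \<open>Sizes drop strictly after an overlined entry, so nothing of size
    \<open>i\<close> follows \<open>Over i\<close>. Used in both directions this gives uniqueness of
    \<open>Over i\<close>, and used once its place after \<open>Plain i\<close>.\<close>
  have 1: "\<not> s < t" if "s \<ge> 1" "?l s = Over i" "part_size (?l t) = i" for s t i
    using from_steps_size_less[OF e, of s t] that from_steps_overlined[of s L e] by fastforce
  have "?l t \<le> ?l s" if "s \<ge> 1" "s \<le> t" for s t
  proof (cases "s < t \<and> overlined (e s)")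
    case True
    then show ?thesis
      using from_steps_size_less[OF e] that by (auto simp: less_eq_part_def)
  next
    case False
    then show ?thesis
      using that from_steps_size_mono[OF that, of L e] from_steps_overlined[of s L e]
      by (auto simp: less_eq_part_def)
  qed
  moreover have "?l \<in> parts_seqs"
    unfolding parts_seqs_def
  proof (intro CollectI conjI allI impI nz fin)
    show "?l 0 = Plain 0"
      by (simp add: from_steps_def)
  next
    fix i a b assume "1 \<le> a" "1 \<le> b" "?l a = Over i \<and> ?l b = Over i"
    then show "a = b"
      using 1[of a i b] 1[of b i a] by simp
  next
    fix i a b assume "1 \<le> a" "1 \<le> b" "?l a = Over i \<and> ?l b = Plain i"
    then show "b < a"
      using 1[of a i b] by (cases a b rule: linorder_cases) auto
  qed
  ultimately show ?thesis
    using out by (simp add: overpartitions_def)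
qed

lemma steps_in_step_set:
  assumes l: "l \<in> overpartitions L"
  shows "steps l \<in> step_set L"
  unfolding step_set_def
proof (intro CollectI conjI ballI allI impI)
  fix t assume "t \<in> {1..L}"
  then show "steps l t \<noteq> Over 0"
    using overpartitions_overlined_step[OF l, of t] by (auto simp: steps_def)
next
  fix t assume "t \<notin> {1..L}"
  then show "steps l t = Plain 0"
    using overpartitionsD(3)[OF l] by (cases "t = 0") (auto simp: steps_def)
qed

lemma from_steps_steps:
  assumes l: "l \<in> overpartitions L"
  shows "from_steps L (steps l) = l"
proof
  fix t
  \<comment> \<open>The drops telescope, by downward induction from \<open>Suc L\<close>, where the
    part is 0. The subtraction in \<open>steps\<close> is exact because sizes decrease.\<close>
  have size: "(\<Sum>r=t..L. part_size (steps l r)) = part_size (l t)" if t: "t \<ge> 1" "t \<le> Suc L" for t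
    using t(2,1)
  proof (induction t rule: inc_induct)
    case base
    then show ?case
      using overpartitionsD(3)[OF l] by simp
  next
    case (step t)
    have "{t..L} = insert t {Suc t..L}"
      using step by auto
    then show ?case
      using step overpartitionsD(4)[OF l, of t "Suc t"] by (simp add: steps_def)
  qed
  show "from_steps L (steps l) t = l t"
  proof (cases "t = 0")
    case True
    then show ?thesis
      using parts_seqsD(1)[OF overpartitionsD(1)[OF l]] by (simp add: from_steps_def)
  next
    case False
    then have "overlined (steps l t) = overlined (l t)"
      by (simp add: steps_def)
    moreover have "(\<Sum>r=t..L. part_size (steps l r)) = part_size (l t)"
      using size[of t] False overpartitionsD(3)[OF l, of t] by (cases "t \<le> Suc L") auto
    ultimately show ?thesis
      using False by (simp add: from_steps_def)
  qed
qed

lemma steps_from_steps: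
  assumes e: "e \<in> step_set L"
  shows "steps (from_steps L e) = e"
proof
  fix t
  show "steps (from_steps L e) t = e t"
  proof (cases "t = 0")
    case True
    then show ?thesis
      using step_setD(2)[OF e, of 0] by (simp add: steps_def)
  next
    case False
    then show ?thesis
      using from_steps_size[OF e, of t] by (simp add: steps_def from_steps_overlined)
  qed
qed

lemma steps_size_pos_iff:
  "t \<ge> 1 \<Longrightarrow> part_size (steps l t) \<noteq> 0 \<longleftrightarrow> part_size (l (Suc t)) < part_size (l t)"
  by (auto simp: steps_def)

section \<open>Weights of overpartitions\<close>

text \<open>The color of all conjugate entries of one size \<open>t\<close>: there are
  \<open>d\<close> of them if the size drops by \<open>d\<close> after position \<open>t\<close>,
  and only the one with the largest index can be overlined. Hence at most one factor
  \<open>x\<close> (the color of \<open>Over t\<close>) beside powers of \<open>y\<close> (the color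
  of \<open>Plain t\<close>).\<close>

fun step_weight :: "'a::comm_monoid_mult \<Rightarrow> 'a \<Rightarrow> part \<Rightarrow> 'a" where
  "step_weight x y (Plain d) = y ^ d"
| "step_weight x y (Over d) = x * y ^ (d - 1)"

lemma prod_nested_intervals:
  fixes f :: "nat \<Rightarrow> nat" and g :: "nat \<Rightarrow> 'a::comm_monoid_mult"
  assumes "\<And>s t. 1 \<le> s \<Longrightarrow> s \<le> t \<Longrightarrow> f t \<le> f s"
  shows "(\<Prod>t=1..n. \<Prod>i=Suc (f (Suc t))..f t. g i) = (\<Prod>i=Suc (f (Suc n))..f 1. g i)"
proof (induction n)
  case (Suc n)
  have le: "f (Suc (Suc n)) \<le> f (Suc n)" "f (Suc n) \<le> f 1"
    using assms by auto
  then have "{Suc (f (Suc (Suc n)))..f 1} =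
      {Suc (f (Suc (Suc n)))..f (Suc n)} \<union> {Suc (f (Suc n))..f 1}"
    by auto
  then have "(\<Prod>i=Suc (f (Suc (Suc n)))..f 1. g i) =
      (\<Prod>i=Suc (f (Suc (Suc n)))..f (Suc n). g i) * (\<Prod>i=Suc (f (Suc n))..f 1. g i)"
    by (simp add: prod.union_disjoint)
  then show ?case
    using Suc by (simp add: mult.commute)
qed simp

lemma finite_range_parts_seq:
  assumes "l \<in> parts_seqs"
  shows "finite (l ` A)"
proof (rule finite_subset)
  show "l ` A \<subseteq> insert (Plain 0) (l ` {i. l i \<noteq> Plain 0})"
    by auto
  show "finite (insert (Plain 0) (l ` {i. l i \<noteq> Plain 0}))"
    using parts_seqsD(3)[OF assms] by simp
qed

lemma max_part_overpartition:
  assumes "l \<in> overpartitions L"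
  shows "max_part l = l 1"
  unfolding max_part_def
proof (rule Max_eqI)
  show "finite (l ` {1..})"
    using overpartitionsD(1)[OF assms] by (rule finite_range_parts_seq)
  show "p \<le> l 1" if "p \<in> l ` {1..}" for p
    using that overpartitionsD(2)[OF assms, of 1] by auto
qed auto

text \<open>The parts of size at least \<open>i\<close> are exactly the first \<open>t\<close>.
  \<open>Over i\<close> can only be the last of them: an overlined part before position
  \<open>t\<close> is strictly larger in size than part \<open>t\<close>, hence larger than
  \<open>i\<close>.\<close>

lemma conjugate_overpartition:
  assumes l: "l \<in> overpartitions L" and t: "t \<ge> 1"
    and i: "part_size (l (Suc t)) < i" "i \<le> part_size (l t)"
  shows "conjugate l i = mk_part (overlined (l t) \<and> i = part_size (l t)) t"
proof -
  have "{j. j \<ge> 1 \<and> l j \<ge> Over i} = {1..t}"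
  proof (intro equalityI subsetI)
    fix j assume j: "j \<in> {j. j \<ge> 1 \<and> l j \<ge> Over i}"
    then have "\<not> Suc t \<le> j"
      using overpartitionsD(4)[OF l, of "Suc t" j] i by (auto simp: Over_le_iff)
    then show "j \<in> {1..t}"
      using j by auto
  next
    fix j assume "j \<in> {1..t}"
    then show "j \<in> {j. j \<ge> 1 \<and> l j \<ge> Over i}"
      using overpartitionsD(4)[OF l, of j t] i by (auto simp: Over_le_iff)
  qed
  then have card: "card {j. j \<ge> 1 \<and> l j \<ge> Over i} = t"
    by simp
  have "(\<exists>j\<ge>1. l j = Over i) \<longleftrightarrow> overlined (l t) \<and> i = part_size (l t)"
  proof
    assume "\<exists>j\<ge>1. l j = Over i"
    then obtain j where j: "j \<ge> 1" "l j = Over i"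
      by blast
    have "\<not> j < t"
    proof
      assume "j < t"
      then have "part_size (l t) \<le> part_size (l (Suc j))"
        using overpartitionsD(4)[OF l, of "Suc j" t] by simp
      also have "\<dots> < part_size (l j)"
        using overpartitions_overlined_step[OF l, of j] j by simp
      finally show False
        using i j by simp
    qed
    moreover have "\<not> Suc t \<le> j"
      using overpartitionsD(4)[OF l, of "Suc t" j] i j by auto
    ultimately have "j = t"
      by simp
    then show "overlined (l t) \<and> i = part_size (l t)"
      using j by simp
  next
    assume "overlined (l t) \<and> i = part_size (l t)"
    then have "l t = Over i"
      by (intro part_eqI) auto
    then show "\<exists>j\<ge>1. l j = Over i"
      using t by blast
  qed
  then show ?thesis
    unfolding conjugate_def card mk_part_def by simp
qed

lemma color_weight_overpartition:
  assumes l: "l \<in> overpartitions L"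
  shows "color_weight c l = (\<Prod>t=1..L. step_weight (c (Over t)) (c (Plain t)) (steps l t))"
proof -
  let ?f = "\<lambda>t. part_size (l t)"
  \<comment> \<open>\<open>Over i \<le> p\<close> only compares sizes. The lower end is 1 because
    \<open>l (Suc L)\<close> is 0; this way of writing it lets the intervals between consecutive
    sizes tile the range.\<close>
  have "{i. Plain 0 < Over i \<and> Over i \<le> max_part l} = {Suc (?f (Suc L))..?f 1}"
    using max_part_overpartition[OF l] overpartitionsD(3)[OF l, of "Suc L"]
    by (auto simp: Over_le_iff less_part_def)
  then have "color_weight c l = (\<Prod>i=Suc (?f (Suc L))..?f 1. c (conjugate l i))"
    by (simp add: color_weight_def)
  also have "\<dots> = (\<Prod>t=1..L. \<Prod>i=Suc (?f (Suc t))..?f t. c (conjugate l i))"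
    by (rule prod_nested_intervals[symmetric]) (rule overpartitionsD(4)[OF l])
  also have "\<dots> = (\<Prod>t=1..L. step_weight (c (Over t)) (c (Plain t)) (steps l t))"
  proof (rule prod.cong[OF refl])
    fix t assume t: "t \<in> {1..L}"
    define a b where "a = ?f (Suc t)" and "b = ?f t"
    have ab: "a \<le> b"
      using overpartitionsD(4)[OF l, of t "Suc t"] t by (simp add: a_def b_def)
    have "(\<Prod>i=Suc a..b. c (conjugate l i)) =
        (\<Prod>i=Suc a..b. if overlined (l t) \<and> i = b then c (Over t) else c (Plain t))"
      using t by (intro prod.cong)
        (auto simp: a_def b_def conjugate_overpartition[OF l] mk_part_def)
    also have "\<dots> = step_weight (c (Over t)) (c (Plain t)) (steps l t)"
    proof (cases "overlined (l t)")
      case True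
      then have "a < b"
        using overpartitions_overlined_step[OF l] t by (simp add: a_def b_def)
      \<comment> \<open>Only the top index \<open>b\<close> carries the overline; the other indices
        account for the exponent \<open>d - 1\<close> in \<open>step_weight\<close>.\<close>
      then have "{Suc a..b} = insert b {Suc a..<b}"
        by auto
      then show ?thesis
        using True t by (simp add: steps_def mk_part_def flip: a_def b_def)
    next
      case False
      then show ?thesis
        using t by (simp add: steps_def mk_part_def flip: a_def b_def)
    qed
    finally show "(\<Prod>i=Suc (?f (Suc t))..?f t. c (conjugate l i)) =
        step_weight (c (Over t)) (c (Plain t)) (steps l t)"
      by (simp only: a_def b_def)
  qed
  finally show ?thesis .
qed

lemma weight_eq_sum:
  assumes "\<And>t. t > L \<Longrightarrow> l t = Plain 0"
  shows "weight s l = (\<Sum>t=1..L. part_size (l t) * s t)"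
  unfolding weight_def
proof (rule sum.mono_neutral_left)
  show "{i. i \<ge> 1 \<and> l i \<noteq> Plain 0} \<subseteq> {1..L}"
    using assms by (fastforce intro: leI)
qed auto

text \<open>Abel summation: each size is the sum of the steps from its position on. After exchanging
  the sums, step \<open>r\<close> is counted with \<open>s t\<close> for every
  \<open>t \<le> r\<close>.\<close>

lemma weight_overpartition:
  assumes l: "l \<in> overpartitions L"
  shows "weight s l = (\<Sum>t=1..L. part_size (steps l t) * partial_sums s t)"
proof -
  have "weight s l = (\<Sum>t=1..L. part_size (l t) * s t)"
    by (rule weight_eq_sum) (rule overpartitionsD(3)[OF l])
  also have "\<dots> = (\<Sum>t=1..L. \<Sum>r | r \<in> {1..L} \<and> t \<le> r. part_size (steps l r) * s t)"
  proof (rule sum.cong[OF refl])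
    fix t assume t: "t \<in> {1..L}"
    then have *: "{r. r \<in> {1..L} \<and> t \<le> r} = {t..L}"
      by auto
    have "part_size (l t) = part_size (from_steps L (steps l) t)"
      using l by (simp add: from_steps_steps)
    also have "\<dots> = (\<Sum>r=t..L. part_size (steps l r))"
      using t by (simp add: from_steps_def)
    finally show "part_size (l t) * s t =
        (\<Sum>r | r \<in> {1..L} \<and> t \<le> r. part_size (steps l r) * s t)"
      unfolding * by (simp add: sum_distrib_right)
  qed
  also have "\<dots> = (\<Sum>r=1..L. \<Sum>t | t \<in> {1..L} \<and> t \<le> r. part_size (steps l r) * s t)"
    by (rule sum.swap_restrict) auto
  also have "\<dots> = (\<Sum>r=1..L. part_size (steps l r) * partial_sums s r)"
  proof (rule sum.cong[OF refl])
    fix r assume "r \<in> {1..L}"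
    then have "{t. t \<in> {1..L} \<and> t \<le> r} = {1..r}"
      by auto
    then show "(\<Sum>t | t \<in> {1..L} \<and> t \<le> r. part_size (steps l r) * s t) =
        part_size (steps l r) * partial_sums s r"
      by (simp add: partial_sums_def sum_distrib_left)
  qed
  finally show ?thesis .
qed

text \<open>There are as many color factors as units of size, so \<open>z\<close> can be given to
  each of them. This fails for \<open>Over 0\<close>, where \<open>d - 1\<close> is cut off at 0 and
  one factor \<open>x\<close> remains.\<close>

lemma step_weight_scale:
  fixes x y z :: "'a::comm_monoid_mult"
  assumes "p \<noteq> Over 0"
  shows "step_weight x y p * z ^ part_size p = step_weight (x * z) (y * z) p"
proof (cases p)
  case (Over d)
  then obtain d' where "d = Suc d'"
    using assms by (cases d) auto
  with Over show ?thesis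
    by (simp add: power_mult_distrib mult_ac)
qed (simp add: power_mult_distrib)

lemma total_weight_overpartition:
  fixes q :: "'a::comm_semiring_1"
  assumes l: "l \<in> overpartitions L"
  shows "color_weight c l * q ^ weight s l =
    (\<Prod>t=1..L. step_weight (c (Over t) * q ^ partial_sums s t)
      (c (Plain t) * q ^ partial_sums s t) (steps l t))"
proof -
  have "q ^ weight s l = (\<Prod>t=1..L. (q ^ partial_sums s t) ^ part_size (steps l t))"
    by (simp add: weight_overpartition[OF l] power_sum power_mult mult.commute)
  then have "color_weight c l * q ^ weight s l =
      (\<Prod>t=1..L. step_weight (c (Over t)) (c (Plain t)) (steps l t) *
        (q ^ partial_sums s t) ^ part_size (steps l t))"
    by (simp only: color_weight_overpartition[OF l] prod.distrib)
  also have "\<dots> = (\<Prod>t=1..L. step_weight (c (Over t) * q ^ partial_sums s t)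
      (c (Plain t) * q ^ partial_sums s t) (steps l t))"
    by (intro prod.cong refl step_weight_scale step_setD(1)[OF steps_in_step_set[OF l]])
  finally show ?thesis .
qed

text \<open>The plain steps form a geometric series that starts at 0 for an unrestricted step and at
  1 for a forced drop, hence 1 against \<open>y\<close>. Overlined steps are positive anyway and
  contribute \<open>x\<close> over \<open>1 - y\<close> in both cases.\<close>

lemma adic_sum_step_weight:
  fixes x y :: "'a::comm_ring_1 fps"
  assumes y: "fps_X dvd y"
  shows "adic_sum (step_weight x y) {p. p \<noteq> Over 0} ((1 + x) * fps_recip (1 - y))"
    and "adic_sum (step_weight x y) {p. part_size p \<noteq> 0} ((y + x) * fps_recip (1 - y))"
proof -
  let ?O = "Over ` Suc ` UNIV" and ?r = "fps_recip (1 - y)"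
  note geo = adic_sum_geometric[OF y]
  have bij_O: "bij_betw (Over \<circ> Suc) UNIV ?O"
    and bij_P: "bij_betw Plain UNIV (range Plain)"
    and bij_S: "bij_betw (Plain \<circ> Suc) UNIV (Plain ` Suc ` UNIV)"
    by (auto simp: bij_betw_def inj_on_def)
  have over: "adic_sum (step_weight x y) ?O (x * ?r)"
    by (rule adic_sum_reindex[OF bij_O adic_sum_cmult[OF geo]]) simp
  have "adic_sum (step_weight x y) (range Plain) ?r"
    by (rule adic_sum_reindex[OF bij_P geo]) simp
  then have "adic_sum (step_weight x y) (range Plain \<union> ?O) (?r + x * ?r)"
    using over by (rule adic_sum_union) auto
  moreover have "range Plain \<union> ?O = {p. p \<noteq> Over 0}"
  proof (intro equalityI subsetI)
    fix p assume p: "p \<in> {p. p \<noteq> Over 0}"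
    show "p \<in> range Plain \<union> ?O"
    proof (cases p)
      case (Over d)
      with p show ?thesis
        by (cases d) auto
    qed auto
  qed auto
  ultimately show "adic_sum (step_weight x y) {p. p \<noteq> Over 0} ((1 + x) * ?r)"
    by (simp add: algebra_simps)
  have "adic_sum (step_weight x y) (Plain ` Suc ` UNIV) (y * ?r)"
    by (rule adic_sum_reindex[OF bij_S adic_sum_cmult[OF geo]]) simp
  then have "adic_sum (step_weight x y) (Plain ` Suc ` UNIV \<union> ?O) (y * ?r + x * ?r)"
    using over by (rule adic_sum_union) auto
  moreover have "Plain ` Suc ` UNIV \<union> ?O = {p. part_size p \<noteq> 0}"
  proof (intro equalityI subsetI)
    fix p assume p: "p \<in> {p. part_size p \<noteq> 0}"
    then obtain d where d: "part_size p = Suc d"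
      using not0_implies_Suc by blast
    show "p \<in> Plain ` Suc ` UNIV \<union> ?O"
    proof (cases p)
      case (Plain d')
      with d show ?thesis
        by auto
    next
      case (Over d')
      with d show ?thesis
        by auto
    qed
  qed auto
  ultimately show "adic_sum (step_weight x y) {p. part_size p \<noteq> 0} ((y + x) * ?r)"
    by (simp add: algebra_simps)
qed

section \<open>Rearrangement by permutations\<close>

lemma bij_betw_permutes_positive:
  assumes "\<pi> permutes {1..(L::nat)}"
  shows "bij_betw \<pi> {1..} {1..}"
  using permutes_imp_bij[OF permutes_subset[OF assms, of "{1..}"]] by auto

lemma conjugate_permute:
  assumes \<pi>: "\<pi> permutes {1..(L::nat)}"
  shows "conjugate (\<lambda>t. l (\<pi> t)) i = conjugate l i"
proof -
  have bij: "bij_betw \<pi> {1..} {1..}"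
    using \<pi> by (rule bij_betw_permutes_positive)
  have "(\<lambda>t. l (\<pi> t)) ` {1..} = l ` \<pi> ` {1..}"
    by (rule image_image[symmetric])
  then have "(\<lambda>t. l (\<pi> t)) ` {1..} = l ` {1..}"
    using bij by (simp add: bij_betw_def)
  moreover have "(\<exists>j\<ge>1. h j = Over i) \<longleftrightarrow> Over i \<in> h ` {1..}" for h :: "nat \<Rightarrow> part"
    by (auto simp: image_iff eq_commute[of "Over i"])
  ultimately have ex: "(\<exists>j\<ge>1. l (\<pi> j) = Over i) \<longleftrightarrow> (\<exists>j\<ge>1. l j = Over i)"
    by presburger
  have "bij_betw \<pi> {j. j \<ge> 1 \<and> l (\<pi> j) \<ge> Over i} {j. j \<ge> 1 \<and> l j \<ge> Over i}"
    unfolding bij_betw_def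
  proof
    show "inj_on \<pi> {j. j \<ge> 1 \<and> l (\<pi> j) \<ge> Over i}"
      using bij by (auto simp: bij_betw_def intro: inj_on_subset)
    show "\<pi> ` {j. j \<ge> 1 \<and> l (\<pi> j) \<ge> Over i} = {j. j \<ge> 1 \<and> l j \<ge> Over i}"
    proof (intro equalityI subsetI)
      fix j assume j: "j \<in> {j. j \<ge> 1 \<and> l j \<ge> Over i}"
      then obtain j' where "j' \<in> {1..}" "j = \<pi> j'"
        using bij by (auto simp: bij_betw_def image_iff set_eq_iff)
      then show "j \<in> \<pi> ` {j. j \<ge> 1 \<and> l (\<pi> j) \<ge> Over i}"
        using j by auto
    next
      fix j assume "j \<in> \<pi> ` {j. j \<ge> 1 \<and> l (\<pi> j) \<ge> Over i}"
      then show "j \<in> {j. j \<ge> 1 \<and> l j \<ge> Over i}"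
        using bij_betwE[OF bij] by auto
    qed
  qed
  then have "card {j. j \<ge> 1 \<and> l (\<pi> j) \<ge> Over i} = card {j. j \<ge> 1 \<and> l j \<ge> Over i}"
    by (rule bij_betw_same_card)
  with ex show ?thesis
    by (simp add: conjugate_def)
qed

lemma color_weight_permute:
  assumes \<pi>: "\<pi> permutes {1..(L::nat)}"
  shows "color_weight c (\<lambda>t. l (\<pi> t)) = color_weight c l"
proof -
  have "(\<lambda>t. l (\<pi> t)) ` {1..} = l ` \<pi> ` {1..}"
    by (rule image_image[symmetric])
  then have "max_part (\<lambda>t. l (\<pi> t)) = max_part l"
    using bij_betw_permutes_positive[OF \<pi>] by (simp add: max_part_def bij_betw_def)
  then show ?thesis
    by (simp add: color_weight_def conjugate_permute[OF \<pi>])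
qed

lemma weight_permute:
  assumes \<pi>: "\<pi> permutes {1..L}"
    and l: "\<And>t. t > L \<Longrightarrow> l t = Plain 0"
    and s: "\<And>t. s (\<pi> t) = s t"
  shows "weight s (\<lambda>t. l (\<pi> t)) = weight s l"
proof -
  have "weight s (\<lambda>t. l (\<pi> t)) = (\<Sum>t=1..L. part_size (l (\<pi> t)) * s t)"
    using l permutes_not_in[OF \<pi>] by (intro weight_eq_sum) auto
  also have "\<dots> = (\<Sum>t=1..L. part_size (l (\<pi> t)) * s (\<pi> t))"
    by (simp add: s)
  also have "\<dots> = (\<Sum>t=1..L. part_size (l t) * s t)"
    using sum.permute[OF \<pi>, of "\<lambda>t. part_size (l t) * s t"] by (simp add: o_def)
  also have "\<dots> = weight s l"
    using l by (intro weight_eq_sum[symmetric]) auto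
  finally show ?thesis .
qed

section \<open>Stable sorting as a permutation: existence and uniqueness\<close>

lemma permutes_finiteI:
  assumes "finite S" "inj_on p S" "\<And>x. x \<in> S \<Longrightarrow> p x \<in> S" "\<And>x. x \<notin> S \<Longrightarrow> p x = x"
  shows "p permutes S"
proof (rule bij_imp_permutes)
  show "bij_betw p S S"
    unfolding bij_betw_def using assms endo_inj_surj[of S p] by blast
qed (use assms in auto)

definition sorts_before :: "(nat \<Rightarrow> 'a::linorder) \<Rightarrow> nat \<Rightarrow> nat \<Rightarrow> bool" where
  "sorts_before f s t \<longleftrightarrow> f t < f s \<or> f s = f t \<and> s < t"

definition stably_sorts :: "nat \<Rightarrow> (nat \<Rightarrow> 'a::linorder) \<Rightarrow> (nat \<Rightarrow> nat) \<Rightarrow> bool" where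
  "stably_sorts L f \<pi> \<longleftrightarrow> \<pi> permutes {1..L} \<and>
     (\<forall>s\<in>{1..L}. \<forall>t\<in>{1..L}. s < t \<longrightarrow> sorts_before f (\<pi> s) (\<pi> t))"

text \<open>The place that position \<open>t\<close> receives in the stable sort, so the sorting
  permutation is the inverse of this map. Outside \<open>{1..L}\<close> it is the identity, as
  \<open>permutes\<close> demands.\<close>

definition sort_rank :: "nat \<Rightarrow> (nat \<Rightarrow> 'a::linorder) \<Rightarrow> nat \<Rightarrow> nat" where
  "sort_rank L f t = (if t \<in> {1..L} then Suc (card {s \<in> {1..L}. sorts_before f s t}) else t)"

lemma sort_rank_less:
  assumes "s \<in> {1..L}" "t \<in> {1..L}" "sorts_before f s t"
  shows "sort_rank L f s < sort_rank L f t"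
proof -
  have "{r \<in> {1..L}. sorts_before f r s} \<subset> {r \<in> {1..L}. sorts_before f r t}"
    using assms by (auto simp: sorts_before_def)
  then have "card {r \<in> {1..L}. sorts_before f r s} < card {r \<in> {1..L}. sorts_before f r t}"
    by (intro psubset_card_mono) auto
  then show ?thesis
    using assms by (simp add: sort_rank_def)
qed

lemma sorts_before_total: "s \<noteq> t \<Longrightarrow> sorts_before f s t \<or> sorts_before f t s"
  by (auto simp: sorts_before_def)

lemma sort_rank_permutes: "sort_rank L f permutes {1..L}"
proof (rule permutes_finiteI)
  show "inj_on (sort_rank L f) {1..L}"
  proof (rule inj_onI, rule ccontr)
    fix s t assume "s \<in> {1..L}" "t \<in> {1..L}" "sort_rank L f s = sort_rank L f t" "s \<noteq> t"
    then show False
      using sorts_before_total[of s t f] sort_rank_less[of s L t f] sort_rank_less[of t L s f]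
      by auto
  qed
  show "sort_rank L f t \<in> {1..L}" if t: "t \<in> {1..L}" for t
  proof -
    have "card {s \<in> {1..L}. sorts_before f s t} \<le> card ({1..L} - {t})"
      by (intro card_mono) (auto simp: sorts_before_def)
    moreover have "card ({1..L} - {t}) < L"
      using t by auto
    ultimately have "card {s \<in> {1..L}. sorts_before f s t} < L"
      by (rule le_less_trans)
    then show ?thesis
      using t by (auto simp: sort_rank_def)
  qed
qed (auto simp: sort_rank_def)

lemma stably_sorts_exists: "\<exists>\<pi>. stably_sorts L f \<pi>"
proof
  let ?\<rho> = "sort_rank L f" and ?\<pi> = "inv (sort_rank L f)"
  have \<pi>: "?\<pi> permutes {1..L}"
    by (rule permutes_inv[OF sort_rank_permutes])
  have "sorts_before f (?\<pi> s) (?\<pi> t)" if st: "s \<in> {1..L}" "t \<in> {1..L}" "s < t" for s t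
  proof (rule ccontr)
    assume contra: "\<not> sorts_before f (?\<pi> s) (?\<pi> t)"
    have rho_pi: "?\<rho> (?\<pi> r) = r" for r
      by (rule permutes_inverses(1)[OF sort_rank_permutes])
    then have "?\<pi> s \<noteq> ?\<pi> t"
      using st by (metis less_irrefl)
    with contra have "sorts_before f (?\<pi> t) (?\<pi> s)"
      using sorts_before_total by metis
    moreover have "?\<pi> s \<in> {1..L}" "?\<pi> t \<in> {1..L}"
      using st permutes_in_image[OF \<pi>] by blast+
    ultimately have "?\<rho> (?\<pi> t) < ?\<rho> (?\<pi> s)"
      by (intro sort_rank_less)
    then show False
      using rho_pi st by simp
  qed
  then show "stably_sorts L f ?\<pi>"
    using \<pi> by (simp add: stably_sorts_def)
qed

text \<open>The positions that sort before \<open>\<pi> t\<close> are precisely the images of 1,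
  ..., t - 1, so \<open>\<pi> t\<close> has rank \<open>t\<close>.\<close>

lemma stably_sorts_unique:
  assumes "stably_sorts L f \<pi>"
  shows "\<pi> = inv (sort_rank L f)"
proof
  fix t
  have \<pi>: "\<pi> permutes {1..L}"
    and sorted: "\<And>s t. s \<in> {1..L} \<Longrightarrow> t \<in> {1..L} \<Longrightarrow> s < t \<Longrightarrow> sorts_before f (\<pi> s) (\<pi> t)"
    using assms by (auto simp: stably_sorts_def)
  have "sort_rank L f (\<pi> t) = t"
  proof (cases "t \<in> {1..L}")
    case True
    have "{s \<in> {1..L}. sorts_before f s (\<pi> t)} = \<pi> ` {1..<t}"
    proof (intro equalityI subsetI)
      fix s assume s: "s \<in> {s \<in> {1..L}. sorts_before f s (\<pi> t)}"
      then obtain r where r: "r \<in> {1..L}" "s = \<pi> r"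
        using permutes_image[OF \<pi>] by blast
      have "\<not> t \<le> r"
        using s r sorted[of t r] True by (cases "t = r") (auto simp: sorts_before_def)
      with r show "s \<in> \<pi> ` {1..<t}"
        by auto
    next
      fix s assume "s \<in> \<pi> ` {1..<t}"
      then obtain r where r: "r \<in> {1..<t}" "s = \<pi> r"
        by blast
      then have "r \<in> {1..L}" "\<pi> r \<in> {1..L}"
        using True permutes_in_image[OF \<pi>, of r] by auto
      then show "s \<in> {s \<in> {1..L}. sorts_before f s (\<pi> t)}"
        using r sorted[of r t] True by auto
    qed
    then have "card {s \<in> {1..L}. sorts_before f s (\<pi> t)} = t - 1"
      using permutes_inj[OF \<pi>] by (simp add: card_image inj_on_subset)
    moreover have "\<pi> t \<in> {1..L}"
      using True permutes_in_image[OF \<pi>] by blast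
    ultimately show ?thesis
      using True by (simp add: sort_rank_def)
  next
    case False
    then show ?thesis
      using permutes_not_in[OF \<pi> False] by (auto simp: sort_rank_def)
  qed
  then show "\<pi> t = inv (sort_rank L f) t"
    using permutes_inverses(2)[OF sort_rank_permutes[of L f]] by metis
qed

text \<open>The number of values at most \<open>c\<close> is invariant under rearrangement, and for
  a weakly increasing function it decides whether the value at \<open>t\<close> is at most
  \<open>c\<close>. Used with \<open>block_of\<close>, to show that stable sorting preserves blocks,
  and with the identity, to show that only the identity has no descents.\<close>

lemma mono_rearrangement_eq:
  fixes g :: "nat \<Rightarrow> nat"
  assumes \<pi>: "\<pi> permutes {1..L}"
    and mono: "\<And>s t. s \<in> {1..L} \<Longrightarrow> t \<in> {1..L} \<Longrightarrow> s \<le> t \<Longrightarrow> g s \<le> g t"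
    and mono': "\<And>s t. s \<in> {1..L} \<Longrightarrow> t \<in> {1..L} \<Longrightarrow> s \<le> t \<Longrightarrow> g (\<pi> s) \<le> g (\<pi> t)"
    and t: "t \<in> {1..L}"
  shows "g (\<pi> t) = g t"
proof -
  let ?A = "\<lambda>c. {s \<in> {1..L}. g s \<le> c}" and ?B = "\<lambda>c. {s \<in> {1..L}. g (\<pi> s) \<le> c}"
  have card_eq: "card (?A c) = card (?B c)" for c
  proof -
    have "\<pi> ` ?B c = ?A c"
    proof (intro equalityI subsetI)
      fix s assume s: "s \<in> ?A c"
      then obtain r where "r \<in> {1..L}" "s = \<pi> r"
        using permutes_image[OF \<pi>] by blast
      then show "s \<in> \<pi> ` ?B c"
        using s by auto
    next
      fix s assume "s \<in> \<pi> ` ?B c"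
      then show "s \<in> ?A c"
        using permutes_in_image[OF \<pi>] by blast
    qed
    then show ?thesis
      using card_image[OF inj_on_subset[OF permutes_inj[OF \<pi>]], of "?B c"] by simp
  qed
  have lower: "t \<le> card {s \<in> {1..L}. h s \<le> c}"
    if "\<And>s. s \<in> {1..L} \<Longrightarrow> s \<le> t \<Longrightarrow> h s \<le> c" for h :: "nat \<Rightarrow> nat" and c
  proof -
    have "card {1..t} \<le> card {s \<in> {1..L}. h s \<le> c}"
      using that t by (intro card_mono) auto
    then show ?thesis by simp
  qed
  have upper: "card {s \<in> {1..L}. h s \<le> c} < t"
    if "\<And>s. s \<in> {1..L} \<Longrightarrow> t \<le> s \<Longrightarrow> c < h s" for h :: "nat \<Rightarrow> nat" and c
  proof -
    have "card {s \<in> {1..L}. h s \<le> c} \<le> card {1..<t}"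
      using that by (intro card_mono) (auto simp: not_le[symmetric])
    then show ?thesis
      using t by auto
  qed
  have "\<not> g (\<pi> t) < g t"
  proof
    assume less: "g (\<pi> t) < g t"
    have "t \<le> card (?B (g (\<pi> t)))"
      using mono' t by (intro lower) auto
    moreover have "card (?A (g (\<pi> t))) < t"
      using mono[OF t] less by (intro upper) (meson less_le_trans)
    ultimately show False
      using card_eq by simp
  qed
  moreover have "\<not> g t < g (\<pi> t)"
  proof
    assume less: "g t < g (\<pi> t)"
    have "t \<le> card (?A (g t))"
      using mono t by (intro lower) auto
    moreover have "card (?B (g t)) < t"
      using mono'[OF t] less by (intro upper) (meson less_le_trans)
    ultimately show False
      using card_eq by simp
  qed
  ultimately show ?thesis
    by simp
qed

lemma less_if_ascents:
  fixes f :: "nat \<Rightarrow> nat"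
  assumes "s < t" "\<And>r. s \<le> r \<Longrightarrow> r < t \<Longrightarrow> f r < f (Suc r)"
  shows "f s < f t"
  using assms
proof (induction t)
  case (Suc t)
  then show ?case
  proof (cases "s = t")
    case False
    with Suc have "f s < f t"
      by auto
    also have "f t < f (Suc t)"
      using Suc.prems by auto
    finally show ?thesis .
  qed auto
qed simp

section \<open>Block overpartitions\<close>

lemma partial_sums_0 [simp]: "partial_sums u 0 = 0"
  by (simp add: partial_sums_def)

lemma partial_sums_Suc: "partial_sums u (Suc r) = partial_sums u r + u (Suc r)"
  by (simp add: partial_sums_def)

locale blocks =
  fixes u :: "nat \<Rightarrow> nat"
  assumes u_pos: "r \<ge> 1 \<Longrightarrow> u r \<ge> 1"
begin

abbreviation U :: "nat \<Rightarrow> nat" where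
  "U \<equiv> partial_sums u"

text \<open>As \<open>U 0 = 0\<close> and \<open>U\<close> increases strictly, exactly the dummy
  position 0 gets number 0; genuine positions get block numbers from 1 on.\<close>

definition block_of :: "nat \<Rightarrow> nat" where
  "block_of t = (LEAST r. t \<le> U r)"

lemma U_less_Suc: "U r < U (Suc r)"
  using u_pos[of "Suc r"] by (simp add: partial_sums_Suc)

lemma strict_mono_U: "strict_mono U"
  using U_less_Suc by (rule strict_monoI_Suc)

lemma U_le_iff: "U r \<le> U r' \<longleftrightarrow> r \<le> r'"
  using strict_mono_U by (rule strict_mono_less_eq)

lemma block_of_le_iff: "block_of t \<le> r \<longleftrightarrow> t \<le> U r"
proof
  have "t \<le> U t"
    using strict_mono_U by (rule strict_mono_imp_increasing)
  then have "t \<le> U (block_of t)"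
    unfolding block_of_def by (rule LeastI)
  also assume "block_of t \<le> r"
  then have "U (block_of t) \<le> U r"
    by (simp add: U_le_iff)
  finally show "t \<le> U r" .
next
  assume "t \<le> U r"
  then show "block_of t \<le> r"
    unfolding block_of_def by (rule Least_le)
qed

lemma block_of_less_iff: "r < block_of t \<longleftrightarrow> U r < t"
  using block_of_le_iff[of t r] by (simp add: not_le[symmetric])

lemma block_of_mono: "s \<le> t \<Longrightarrow> block_of s \<le> block_of t"
  by (meson block_of_le_iff le_trans order_refl)

lemma block_of_eq_Suc_iff: "block_of t = Suc r \<longleftrightarrow> U r < t \<and> t \<le> U (Suc r)"
  using block_of_less_iff[of r t] block_of_le_iff[of t "Suc r"] by auto

lemma block_of_pos_iff: "block_of t > 0 \<longleftrightarrow> t > 0"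
  using block_of_less_iff[of 0 t] by simp

text \<open>The definition compares only neighbouring blocks. No block is empty, so the inequalities
  chain through an element of each block in between.\<close>

lemma block_overpartitions_iff:
  "l \<in> block_overpartitions u \<longleftrightarrow>
     l \<in> parts_seqs \<and> (\<forall>a\<ge>1. \<forall>b. block_of a < block_of b \<longrightarrow> l b \<le> l a)"
proof -
  \<comment> \<open>\<open>?B r\<close> is block number \<open>Suc r\<close>; the shift absorbs the
    restriction \<open>r \<ge> 1\<close>.\<close>
  let ?B = "\<lambda>r. {U r + 1..U (Suc r)}"
  have B: "t \<in> ?B r \<longleftrightarrow> block_of t = Suc r" for t r
    by (auto simp: block_of_eq_Suc_iff)
  have ne: "?B r \<noteq> {}" for r
    using U_less_Suc[of r] by auto
  have "(\<forall>r\<ge>1. Min (l ` {U (r - 1) + 1..U r}) \<ge> Max (l ` {U r + 1..U (r + 1)})) \<longleftrightarrow>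
      (\<forall>r. Min (l ` ?B r) \<ge> Max (l ` ?B (Suc r)))"
    by (metis One_nat_def Suc_eq_plus1 Suc_le_D diff_Suc_1 le_add2)
  also have "\<dots> \<longleftrightarrow> (\<forall>r. \<forall>a\<in>?B r. \<forall>b\<in>?B (Suc r). l b \<le> l a)"
  proof -
    have "Min (l ` ?B r) \<ge> Max (l ` ?B (Suc r)) \<longleftrightarrow> (\<forall>a\<in>?B r. \<forall>b\<in>?B (Suc r). l b \<le> l a)" for r
      by (subst Min_ge_iff; (subst Max_le_iff)?) (use ne[of r] ne[of "Suc r"] in auto)
    then show ?thesis by simp
  qed
  also have "\<dots> \<longleftrightarrow> (\<forall>r a b. block_of a = Suc r \<and> block_of b = Suc (Suc r) \<longrightarrow> l b \<le> l a)"
    by (metis B)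
  also have "\<dots> \<longleftrightarrow> (\<forall>a\<ge>1. \<forall>b. block_of a < block_of b \<longrightarrow> l b \<le> l a)" (is "?consec \<longleftrightarrow> ?all")
  proof
    assume ?all
    then show ?consec
      using block_of_pos_iff by (metis One_nat_def Suc_leI lessI zero_less_Suc)
  next
    assume consec: ?consec
    have *: "l b \<le> l a" if "block_of a = Suc r" "block_of b = Suc (Suc (r + j))" for a b r j
      using that
    proof (induction j arbitrary: b)
      case 0
      then show ?case using consec by simp
    next
      case (Suc j)
      obtain x where x: "block_of x = Suc (Suc (r + j))"
        using ne[of "Suc (r + j)"] B by blast
      then have "l x \<le> l a"
        using Suc by blast
      moreover have "l b \<le> l x"
        using consec x Suc.prems by simp
      ultimately show ?case
        by simp
    qed
    show ?all
    proof (intro allI impI)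
      fix a b assume "1 \<le> (a::nat)" and less: "block_of a < block_of b"
      then obtain r where r: "block_of a = Suc r"
        using block_of_pos_iff[of a] by (auto dest: gr0_implies_Suc)
      obtain j where "block_of b = Suc (Suc (r + j))"
        using less r by (metis add_Suc_shift less_iff_Suc_add add_Suc)
      with r show "l b \<le> l a"
        by (rule *)
    qed
  qed
  finally show ?thesis
    unfolding block_overpartitions_def by simp
qed

definition truncated_overpartitions :: "nat \<Rightarrow> (nat \<Rightarrow> part) set" where
  "truncated_overpartitions R = {l \<in> block_overpartitions u. \<forall>t>U R. l t = Plain 0}"

definition block_perms :: "nat \<Rightarrow> (nat \<Rightarrow> nat) set" where
  "block_perms R = {\<pi>. \<pi> permutes {1..U R} \<and> (\<forall>t. block_of (\<pi> t) = block_of t)}"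

text \<open>A strict drop of the part would not do: with \<open>Plain i\<close> at \<open>t\<close>,
  \<open>Over i\<close> at \<open>Suc t\<close> and a descent of \<open>\<pi>\<close> at
  \<open>t\<close>, undoing \<open>\<pi>\<close> would place \<open>Over i\<close> before
  \<open>Plain i\<close>. The last position \<open>U R\<close> is never a descent, since
  \<open>\<pi>\<close> fixes its successor.\<close>

definition descent_compatible :: "nat \<Rightarrow> (nat \<Rightarrow> nat) \<Rightarrow> (nat \<Rightarrow> part) set" where
  "descent_compatible R \<pi> = {m \<in> overpartitions (U R).
     \<forall>t\<in>{1..U R}. \<pi> (Suc t) < \<pi> t \<longrightarrow> part_size (m (Suc t)) < part_size (m t)}"

lemma finite_block_perms: "finite (block_perms R)"
  unfolding block_perms_def
  by (rule finite_subset[OF _ finite_permutations[of "{1..U R}"]]) auto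

text \<open>Equal sizes at both ends force equal sizes in between, so no descent can occur on the
  way.\<close>

lemma descent_compatible_less:
  assumes \<pi>: "\<pi> permutes {1..U R}" and m: "m \<in> descent_compatible R \<pi>"
    and st: "1 \<le> s" "s < t" "t \<le> U R" "part_size (m s) = part_size (m t)"
  shows "\<pi> s < \<pi> t"
  using st(2)
proof (rule less_if_ascents)
  fix r assume r: "s \<le> r" "r < t"
  have m': "m \<in> overpartitions (U R)"
    using m by (simp add: descent_compatible_def)
  have "part_size (m r) \<le> part_size (m (Suc r))"
    using overpartitionsD(4)[OF m', of s r] overpartitionsD(4)[OF m', of "Suc r" t] st r by simp
  then have "\<not> \<pi> (Suc r) < \<pi> r"
    using m r st by (auto simp: descent_compatible_def)
  moreover have "\<pi> r \<noteq> \<pi> (Suc r)"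
    using permutes_inj[OF \<pi>] by (metis injD n_not_Suc_n)
  ultimately show "\<pi> r < \<pi> (Suc r)"
    by simp
qed

lemma rearrange_in_truncated:
  assumes \<pi>: "\<pi> \<in> block_perms R" and m: "m \<in> descent_compatible R \<pi>"
  shows "(\<lambda>t. m (inv \<pi> t)) \<in> truncated_overpartitions R"
proof -
  let ?l = "\<lambda>t. m (inv \<pi> t)"
  have p: "\<pi> permutes {1..U R}" and blk: "\<And>t. block_of (\<pi> t) = block_of t"
    using \<pi> by (auto simp: block_perms_def)
  have p': "inv \<pi> permutes {1..U R}"
    using p by (rule permutes_inv)
  note inv = permutes_inverses[OF p]
  have m': "m \<in> overpartitions (U R)" and seq: "m \<in> parts_seqs"
    using m overpartitionsD(1) by (auto simp: descent_compatible_def)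
  have pos: "inv \<pi> t \<ge> 1" if "t \<ge> 1" for t
    using that permutes_in_image[OF p', of t] permutes_not_in[OF p', of t]
    by (cases "t \<in> {1..U R}") auto
  have out: "?l t = Plain 0" if "t > U R" for t
    using that permutes_not_in[OF p', of t] overpartitionsD(3)[OF m'] by simp
  have "?l \<in> parts_seqs"
    unfolding parts_seqs_def
  proof (intro CollectI conjI allI impI)
    show "?l 0 = Plain 0"
      using permutes_not_in[OF p', of 0] parts_seqsD(1)[OF seq] by simp
    show "?l i \<noteq> Over 0" for i
      using parts_seqsD(2)[OF seq] by simp
    show "finite {i. ?l i \<noteq> Plain 0}"
    proof (rule finite_subset)
      show "{i. ?l i \<noteq> Plain 0} \<subseteq> {..U R}"
        using out by (fastforce intro: leI)
    qed simp
  next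
    fix i a b assume "1 \<le> a" "1 \<le> b" "?l a = Over i \<and> ?l b = Over i"
    then have "inv \<pi> a = inv \<pi> b"
      using parts_seqsD(4)[OF seq] pos by blast
    then show "a = b"
      using inv(1) by metis
  next
    fix i a b assume ab: "1 \<le> a" "1 \<le> b" "?l a = Over i \<and> ?l b = Plain i"
    then have less: "inv \<pi> b < inv \<pi> a"
      using parts_seqsD(5)[OF seq] pos by blast
    have "?l a \<noteq> Plain 0"
      using ab by auto
    then have "inv \<pi> a \<le> U R"
      using overpartitionsD(3)[OF m'] leI by blast
    \<comment> \<open>Both entries have size \<open>i\<close>, so they lie on a run of constant
      size, along which \<open>\<pi>\<close> increases.\<close>
    then have "\<pi> (inv \<pi> b) < \<pi> (inv \<pi> a)"
      using ab pos by (intro descent_compatible_less[OF p m _ less]) auto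
    then show "b < a"
      by (simp add: inv)
  qed
  moreover have "?l b \<le> ?l a" if "a \<ge> 1" "block_of a < block_of b" for a b
  proof -
    have "block_of (inv \<pi> a) < block_of (inv \<pi> b)"
      using that(2) blk inv(1) by metis
    then have "inv \<pi> a \<le> inv \<pi> b"
      using block_of_mono[of "inv \<pi> b" "inv \<pi> a"] by linarith
    then show ?thesis
      using overpartitionsD(2)[OF m'] pos that(1) by blast
  qed
  ultimately show ?thesis
    using out by (simp add: truncated_overpartitions_def block_overpartitions_iff)
qed

text \<open>This recovers \<open>\<pi>\<close> from the rearranged sequence alone, which gives
  injectivity of the rearrangement map.\<close>

lemma rearrange_stably_sorts:
  assumes \<pi>: "\<pi> \<in> block_perms R" and m: "m \<in> descent_compatible R \<pi>"
  shows "stably_sorts (U R) (\<lambda>t. m (inv \<pi> t)) \<pi>"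
  unfolding stably_sorts_def
proof (intro conjI ballI impI)
  show p: "\<pi> permutes {1..U R}"
    using \<pi> by (simp add: block_perms_def)
  fix s t assume st: "s \<in> {1..U R}" "t \<in> {1..U R}" "s < t"
  have "m \<in> overpartitions (U R)"
    using m by (simp add: descent_compatible_def)
  then have "m t \<le> m s"
    using overpartitionsD(2) st by auto
  moreover have "\<pi> s < \<pi> t" if "m s = m t"
    using descent_compatible_less[OF p m] st that by auto
  ultimately show "sorts_before (\<lambda>t. m (inv \<pi> t)) (\<pi> s) (\<pi> t)"
    by (auto simp: sorts_before_def permutes_inverses[OF p])
qed

text \<open>Later blocks hold parts that are no larger, and ties are broken by position, so the sort
  never lists a later block before an earlier one. Thus \<open>block_of\<close> stays weakly
  increasing after composition with \<open>\<pi>\<close> and is therefore unchanged.\<close>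

lemma stable_sort_block_perm:
  assumes l: "l \<in> truncated_overpartitions R" and sorts: "stably_sorts (U R) l \<pi>"
  shows "\<pi> \<in> block_perms R" "(\<lambda>t. l (\<pi> t)) \<in> descent_compatible R \<pi>"
proof -
  let ?m = "\<lambda>t. l (\<pi> t)"
  have p: "\<pi> permutes {1..U R}"
    and sorted: "\<And>s t. s \<in> {1..U R} \<Longrightarrow> t \<in> {1..U R} \<Longrightarrow> s < t \<Longrightarrow> sorts_before l (\<pi> s) (\<pi> t)"
    using sorts by (auto simp: stably_sorts_def)
  have seq: "l \<in> parts_seqs" and out: "\<And>t. t > U R \<Longrightarrow> l t = Plain 0"
    and blk: "\<And>a b. a \<ge> 1 \<Longrightarrow> block_of a < block_of b \<Longrightarrow> l b \<le> l a"
    using l by (auto simp: truncated_overpartitions_def block_overpartitions_iff)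
  have pos: "\<pi> t \<ge> 1" if "t \<ge> 1" for t
    using that permutes_in_image[OF p, of t] permutes_not_in[OF p, of t]
    by (cases "t \<in> {1..U R}") auto
  have out': "?m t = Plain 0" if "t > U R" for t
    using that permutes_not_in[OF p, of t] out by simp
  have "block_of (\<pi> s) \<le> block_of (\<pi> t)" if st: "s \<in> {1..U R}" "t \<in> {1..U R}" "s \<le> t" for s t
  proof (cases "s = t")
    case False
    then have before: "sorts_before l (\<pi> s) (\<pi> t)"
      using sorted st by simp
    show ?thesis
    proof (rule ccontr)
      assume contra: "\<not> block_of (\<pi> s) \<le> block_of (\<pi> t)"
      then have "l (\<pi> s) \<le> l (\<pi> t)"
        using blk pos st by auto
      with before have "\<pi> s < \<pi> t"
        by (auto simp: sorts_before_def)
      then show False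
        using contra block_of_mono[of "\<pi> s" "\<pi> t"] by simp
    qed
  qed simp
  then have "block_of (\<pi> t) = block_of t" if "t \<in> {1..U R}" for t
    using that block_of_mono by (intro mono_rearrangement_eq[OF p]) auto
  then have "block_of (\<pi> t) = block_of t" for t
    using permutes_not_in[OF p, of t] by (cases "t \<in> {1..U R}") auto
  with p show "\<pi> \<in> block_perms R"
    by (simp add: block_perms_def)
  have mono: "?m t \<le> ?m s" if "s \<ge> 1" "s \<le> t" for s t
  proof (cases "s < t \<and> t \<le> U R")
    case True
    then show ?thesis
      using sorted[of s t] that by (auto simp: sorts_before_def)
  next
    case False
    then show ?thesis
      using that out'[of t] Plain_0_le parts_seqsD(2)[OF seq] by (cases "s = t") auto
  qed
  have "?m \<in> parts_seqs"
    unfolding parts_seqs_def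
  proof (intro CollectI conjI allI impI)
    show "?m 0 = Plain 0"
      using permutes_not_in[OF p, of 0] parts_seqsD(1)[OF seq] by simp
    show "?m i \<noteq> Over 0" for i
      using parts_seqsD(2)[OF seq] by simp
    show "finite {i. ?m i \<noteq> Plain 0}"
    proof (rule finite_subset)
      show "{i. ?m i \<noteq> Plain 0} \<subseteq> {..U R}"
        using out' by (fastforce intro: leI)
    qed simp
  next
    fix i a b assume "1 \<le> a" "1 \<le> b" "?m a = Over i \<and> ?m b = Over i"
    then have "\<pi> a = \<pi> b"
      using parts_seqsD(4)[OF seq] pos by blast
    then show "a = b"
      using permutes_inj[OF p] by (simp add: inj_eq)
  next
    fix i a b assume ab: "1 \<le> a" "1 \<le> b" "?m a = Over i \<and> ?m b = Plain i"
    then have "\<not> a \<le> b"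
      using mono[of a b] by (auto simp: less_eq_part_def)
    then show "b < a"
      by simp
  qed
  then have "?m \<in> overpartitions (U R)"
    using mono out' by (simp add: overpartitions_def)
  moreover have "part_size (?m (Suc t)) < part_size (?m t)"
    if t: "t \<in> {1..U R}" "\<pi> (Suc t) < \<pi> t" for t
  proof -
    have "Suc t \<le> U R"
    proof (rule ccontr)
      assume "\<not> Suc t \<le> U R"
      then have "\<pi> (Suc t) = Suc t" "\<pi> t \<le> t"
        using permutes_not_in[OF p, of "Suc t"] permutes_in_image[OF p, of t] t by auto
      then show False
        using t by simp
    qed
    then have less: "?m (Suc t) < ?m t"
      using sorted[of t "Suc t"] t by (auto simp: sorts_before_def)
    \<comment> \<open>At a descent stability excludes a tie, so the part drops strictly. With equal
      sizes this leaves \<open>Plain i\<close> followed by \<open>Over i\<close>, whose positions in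
      \<open>l\<close> are in ascending order by \<open>parts_seqs\<close>.\<close>
    have False if eq: "part_size (?m (Suc t)) = part_size (?m t)"
    proof -
      have "overlined (?m (Suc t))" "\<not> overlined (?m t)"
        using less eq by (auto simp: less_part_def)
      then obtain i where "?m (Suc t) = Over i" "?m t = Plain i"
        using eq by (cases "?m t"; cases "?m (Suc t)") auto
      then have "\<pi> t < \<pi> (Suc t)"
        using parts_seqsD(5)[OF seq] pos t by auto
      then show False
        using t by simp
    qed
    then show ?thesis
      using less by (auto simp: less_part_def)
  qed
  ultimately show "?m \<in> descent_compatible R \<pi>"
    by (simp add: descent_compatible_def)
qed

lemma bij_betw_rearrange:
  "bij_betw (\<lambda>(\<pi>, m) t. m (inv \<pi> t))
     (Sigma (block_perms R) (descent_compatible R)) (truncated_overpartitions R)"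
  unfolding bij_betw_def
proof
  show "inj_on (\<lambda>(\<pi>, m) t. m (inv \<pi> t)) (Sigma (block_perms R) (descent_compatible R))"
  proof (rule inj_onI, clarify)
    fix \<pi> m \<pi>' m'
    assume p: "\<pi> \<in> block_perms R" "m \<in> descent_compatible R \<pi>"
      and p': "\<pi>' \<in> block_perms R" "m' \<in> descent_compatible R \<pi>'"
      and eq: "(\<lambda>t. m (inv \<pi> t)) = (\<lambda>t. m' (inv \<pi>' t))"
    have "\<pi> = \<pi>'"
      using stably_sorts_unique[OF rearrange_stably_sorts[OF p]]
        stably_sorts_unique[OF rearrange_stably_sorts[OF p']] eq by simp
    moreover have "m t = m' t" for t
      using fun_cong[OF eq, of "\<pi> t"] p(1) permutes_inverses(2)[of \<pi> "{1..U R}"]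
      unfolding \<open>\<pi> = \<pi>'\<close> by (simp add: block_perms_def)
    ultimately show "\<pi> = \<pi>' \<and> m = m'"
      by auto
  qed
  show "(\<lambda>(\<pi>, m) t. m (inv \<pi> t)) ` Sigma (block_perms R) (descent_compatible R) =
      truncated_overpartitions R"
  proof (intro equalityI subsetI)
    fix l assume "l \<in> (\<lambda>(\<pi>, m) t. m (inv \<pi> t)) ` Sigma (block_perms R) (descent_compatible R)"
    then show "l \<in> truncated_overpartitions R"
      using rearrange_in_truncated by auto
  next
    fix l assume l: "l \<in> truncated_overpartitions R"
    obtain \<pi> where \<pi>: "stably_sorts (U R) l \<pi>"
      using stably_sorts_exists by blast
    have "(\<pi>, \<lambda>t. l (\<pi> t)) \<in> Sigma (block_perms R) (descent_compatible R)"
      using stable_sort_block_perm[OF l \<pi>] by simp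
    moreover have "l = (\<lambda>(\<pi>, m) t. m (inv \<pi> t)) (\<pi>, \<lambda>t. l (\<pi> t))"
      using \<pi> by (auto simp: stably_sorts_def permutes_inverses)
    ultimately show "l \<in> (\<lambda>(\<pi>, m) t. m (inv \<pi> t)) ` Sigma (block_perms R) (descent_compatible R)"
      by (rule rev_image_eqI)
  qed
qed

text \<open>In step coordinates the descent condition becomes one separate condition
  \<open>A t\<close> per position, so the sum over \<open>m\<close> is a product of one-variable
  sums.\<close>

lemma adic_sum_descent_compatible:
  fixes x y :: "nat \<Rightarrow> 'a::comm_ring_1 fps"
  assumes y: "\<And>t. t \<in> {1..U R} \<Longrightarrow> fps_X dvd y t"
  shows "adic_sum (\<lambda>m. \<Prod>t=1..U R. step_weight (x t) (y t) (steps m t)) (descent_compatible R \<pi>)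
    (\<Prod>t=1..U R. (y t ^ of_bool (\<pi> (Suc t) < \<pi> t) + x t) * fps_recip (1 - y t))"
proof -
  define A where "A t = (if \<pi> (Suc t) < \<pi> t then {p. part_size p \<noteq> 0} else {p. p \<noteq> Over 0})" for t
  let ?E = "{e. (\<forall>t\<in>{1..U R}. e t \<in> A t) \<and> (\<forall>t. t \<notin> {1..U R} \<longrightarrow> e t = Plain 0)}"
  have "adic_sum (step_weight (x t) (y t)) (A t)
      ((y t ^ of_bool (\<pi> (Suc t) < \<pi> t) + x t) * fps_recip (1 - y t))" if "t \<in> {1..U R}" for t
    using adic_sum_step_weight[OF y[OF that], of "x t"] by (simp add: A_def)
  then have sum: "adic_sum (\<lambda>e. \<Prod>t=1..U R. step_weight (x t) (y t) (e t)) ?E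
      (\<Prod>t=1..U R. (y t ^ of_bool (\<pi> (Suc t) < \<pi> t) + x t) * fps_recip (1 - y t))"
    by (intro adic_sum_functions) auto
  have E: "e \<in> step_set (U R)" if "e \<in> ?E" for e
    using that by (auto simp: step_set_def A_def split: if_splits)
  have bij: "bij_betw (from_steps (U R)) ?E (descent_compatible R \<pi>)"
  proof (rule bij_betw_byWitness[of _ steps])
    show "\<forall>e\<in>?E. steps (from_steps (U R) e) = e"
      using E steps_from_steps by blast
    show "\<forall>m\<in>descent_compatible R \<pi>. from_steps (U R) (steps m) = m"
      using from_steps_steps by (auto simp: descent_compatible_def)
    show "from_steps (U R) ` ?E \<subseteq> descent_compatible R \<pi>"
    proof clarify
      fix e assume "\<forall>t\<in>{1..U R}. e t \<in> A t" "\<forall>t. t \<notin> {1..U R} \<longrightarrow> e t = Plain 0"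
      then have e: "e \<in> ?E"
        by blast
      let ?m = "from_steps (U R) e"
      have "part_size (?m (Suc t)) < part_size (?m t)" if t: "t \<in> {1..U R}" "\<pi> (Suc t) < \<pi> t" for t
      proof -
        have "e t \<in> A t"
          using e t by blast
        then have "part_size (steps ?m t) \<noteq> 0"
          using t by (simp add: steps_from_steps[OF E[OF e]] A_def)
        then show ?thesis
          using t steps_size_pos_iff[of t ?m] by simp
      qed
      then show "?m \<in> descent_compatible R \<pi>"
        using from_steps_in_overpartitions[OF E[OF e]] by (simp add: descent_compatible_def)
    qed
    show "steps ` descent_compatible R \<pi> \<subseteq> ?E"
    proof clarify
      fix m assume m: "m \<in> descent_compatible R \<pi>"
      then have step: "steps m \<in> step_set (U R)"
        by (simp add: steps_in_step_set descent_compatible_def)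
      have "steps m t \<in> A t" if "t \<in> {1..U R}" for t
        using that m steps_size_pos_iff[of t m] step_setD(1)[OF step, of t]
        by (auto simp: A_def descent_compatible_def)
      then show "(\<forall>t\<in>{1..U R}. steps m t \<in> A t) \<and> (\<forall>t. t \<notin> {1..U R} \<longrightarrow> steps m t = Plain 0)"
        using step_setD(2)[OF step] by blast
    qed
  qed
  show ?thesis
    by (rule adic_sum_reindex[OF bij sum]) (simp only: steps_from_steps[OF E])
qed

end

text \<open>A permutation of \<open>{1..n}\<close> fixes \<open>n + 1\<close>, so position
  \<open>n\<close> is never a descent and its factor \<open>1 + x n\<close> comes out of the sum.
  This is the origin of the last argument 1 of the descent polynomial.\<close>

lemma euler_over_eq_sum:
  fixes x y :: "nat \<Rightarrow> 'a::comm_semiring_1"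
  assumes "n \<ge> 1"
  shows "euler_over n x (\<lambda>m. if m = n then 1 else y m) =
    (\<Sum>\<sigma> | \<sigma> permutes {1..n}. \<Prod>m=1..n. y m ^ of_bool (\<sigma> (Suc m) < \<sigma> m) + x m)"
proof -
  have "(\<Prod>m=1..n. y m ^ of_bool (\<sigma> (Suc m) < \<sigma> m) + x m) =
      (1 + x n) * (\<Prod>m=1..n-1. (if m = n then 1 else y m) ^ of_bool (\<sigma> m > \<sigma> (m + 1)) + x m)"
    if \<sigma>: "\<sigma> permutes {1..n}" for \<sigma>
  proof -
    have "{1..n} = insert n {1..n-1}"
      using assms by auto
    moreover have "\<sigma> n \<le> n" "\<sigma> (Suc n) = Suc n"
      using permutes_in_image[OF \<sigma>, of n] permutes_not_in[OF \<sigma>, of "Suc n"] assms by auto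
    moreover have "(\<Prod>m=1..n-1. y m ^ of_bool (\<sigma> (Suc m) < \<sigma> m) + x m) =
        (\<Prod>m=1..n-1. (if m = n then 1 else y m) ^ of_bool (\<sigma> m > \<sigma> (m + 1)) + x m)"
      by (rule prod.cong) auto
    ultimately show ?thesis
      using assms by simp
  qed
  then show ?thesis
    by (simp add: euler_over_def sum_distrib_left)
qed

section \<open>Factoring the sum over block permutations\<close>

context blocks
begin

text \<open>A block permutation respects the cut at \<open>U R\<close>, so it splits into its
  restriction below the cut and its action on the last block, shifted down to start at 1.\<close>

lemma bij_betw_block_perms_Suc:
  "bij_betw (\<lambda>(\<pi>, \<sigma>) t. if t \<le> U R then \<pi> t else U R + \<sigma> (t - U R))
     (block_perms R \<times> {\<sigma>. \<sigma> permutes {1..u (Suc R)}}) (block_perms (Suc R))"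
proof (rule bij_betw_byWitness[where
      f' = "\<lambda>\<tau>. (\<lambda>t. if t \<le> U R then \<tau> t else t, \<lambda>m. if m = 0 then 0 else \<tau> (U R + m) - U R)"])
  let ?glue = "\<lambda>(\<pi>, \<sigma>) t. if t \<le> U R then \<pi> t else U R + \<sigma> (t - U R)"
  let ?split = "\<lambda>\<tau>. (\<lambda>t. if t \<le> U R then \<tau> t else t, \<lambda>m. if m = 0 then 0 else \<tau> (U R + m) - U R)"
  let ?P = "block_perms R \<times> {\<sigma>. \<sigma> permutes {1..u (Suc R)}}"
  have block_permsD: "\<pi> permutes {1..U r}" "block_of (\<pi> t) = block_of t" "\<pi> t \<le> U r' \<longleftrightarrow> t \<le> U r'"
    if "\<pi> \<in> block_perms r" for \<pi> r r' t
    using that block_of_le_iff by (auto simp: block_perms_def) (metis block_of_le_iff)+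
  show "\<forall>p\<in>?P. ?split (?glue p) = p"
  proof clarify
    fix \<pi> \<sigma> assume \<pi>: "\<pi> \<in> block_perms R" and \<sigma>: "\<sigma> permutes {1..u (Suc R)}"
    have "\<pi> t = t" if "\<not> t \<le> U R" for t
      using that permutes_not_in[OF block_permsD(1)[OF \<pi>], of t] by auto
    moreover have "\<sigma> 0 = 0"
      using permutes_not_in[OF \<sigma>, of 0] by simp
    ultimately show "(\<lambda>t. if t \<le> U R then if t \<le> U R then \<pi> t else U R + \<sigma> (t - U R) else t) = \<pi> \<and>
        (\<lambda>m. if m = 0 then 0 else
          (if U R + m \<le> U R then \<pi> (U R + m) else U R + \<sigma> (U R + m - U R)) - U R) = \<sigma>"
      by auto
  qed
  show "\<forall>\<tau>\<in>block_perms (Suc R). ?glue (?split \<tau>) = \<tau>"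
  proof
    fix \<tau> assume \<tau>: "\<tau> \<in> block_perms (Suc R)"
    show "?glue (?split \<tau>) = \<tau>"
    proof
      fix t
      have "U R \<le> \<tau> t" if "\<not> t \<le> U R"
        using block_permsD(3)[OF \<tau>, of t R] that by simp
      then show "?glue (?split \<tau>) t = \<tau> t"
        by auto
    qed
  qed
  show "?glue ` ?P \<subseteq> block_perms (Suc R)"
  proof clarify
    fix \<pi> \<sigma> assume \<pi>: "\<pi> \<in> block_perms R" and \<sigma>: "\<sigma> permutes {1..u (Suc R)}"
    let ?\<tau> = "\<lambda>t. if t \<le> U R then \<pi> t else U R + \<sigma> (t - U R)"
    have \<sigma>_le: "1 \<le> \<sigma> m \<and> \<sigma> m \<le> u (Suc R)" if "1 \<le> m" "m \<le> u (Suc R)" for m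
      using that permutes_in_image[OF \<sigma>, of m] by auto
    have \<sigma>_pos: "1 \<le> \<sigma> m" if "1 \<le> m" for m
      using that \<sigma>_le[of m] permutes_not_in[OF \<sigma>, of m] by (cases "m \<le> u (Suc R)") auto
    have \<pi>_le: "\<pi> t \<le> U R \<longleftrightarrow> t \<le> U R" for t
      by (rule block_permsD(3)[OF \<pi>])
    have out: "?\<tau> t = t" if "t \<notin> {1..U (Suc R)}" for t
    proof (cases "t \<le> U R")
      case True
      then have "t = 0"
        using that U_less_Suc[of R] by auto
      then show ?thesis
        using permutes_not_in[OF block_permsD(1)[OF \<pi>], of 0] by simp
    next
      case False
      then have "t - U R \<notin> {1..u (Suc R)}"
        using that by (auto simp: partial_sums_Suc)
      then show ?thesis
        using permutes_not_in[OF \<sigma>] False by simp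
    qed
    have in_block: "U R < ?\<tau> t \<and> ?\<tau> t \<le> U (Suc R)" if "U R < t" "t \<le> U (Suc R)" for t
    proof -
      have "1 \<le> t - U R" "t - U R \<le> u (Suc R)"
        using that by (auto simp: partial_sums_Suc)
      then show ?thesis
        using \<sigma>_le[of "t - U R"] that by (simp add: partial_sums_Suc)
    qed
    have blk: "block_of (?\<tau> t) = block_of t" for t
    proof (cases "U R < t \<and> t \<le> U (Suc R)")
      case True
      then have "block_of t = Suc R" "block_of (?\<tau> t) = Suc R"
        using in_block[of t] unfolding block_of_eq_Suc_iff by auto
      then show ?thesis
        by simp
    next
      case False
      then show ?thesis
        using out[of t] block_permsD(2)[OF \<pi>, of t] by (cases "t \<le> U R") auto
    qed
    have "?\<tau> permutes {1..U (Suc R)}"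
    proof (rule permutes_finiteI)
      show "inj_on ?\<tau> {1..U (Suc R)}"
      proof (rule inj_onI)
        fix a b assume ab: "a \<in> {1..U (Suc R)}" "b \<in> {1..U (Suc R)}" and eq: "?\<tau> a = ?\<tau> b"
        have "block_of a = block_of b"
          using blk[of a] blk[of b] unfolding eq by (rule trans[OF sym])
        then have "a \<le> U R \<longleftrightarrow> b \<le> U R"
          using block_of_le_iff[of a R] block_of_le_iff[of b R] by simp
        then show "a = b"
          using eq permutes_inj[OF block_permsD(1)[OF \<pi>]] permutes_inj[OF \<sigma>]
          by (auto simp: inj_eq split: if_splits)
      qed
      show "?\<tau> t \<in> {1..U (Suc R)}" if "t \<in> {1..U (Suc R)}" for t
      proof -
        have "?\<tau> t > 0"
          using that block_of_pos_iff[of t] block_of_pos_iff[of "?\<tau> t"] unfolding blk by simp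
        moreover have "?\<tau> t \<le> U (Suc R)"
          using that block_of_le_iff[of t "Suc R"] block_of_le_iff[of "?\<tau> t" "Suc R"]
          unfolding blk by simp
        ultimately show ?thesis
          unfolding atLeastAtMost_iff by linarith
      qed
    qed (use out in auto)
    then show "?\<tau> \<in> block_perms (Suc R)"
      using blk by (simp add: block_perms_def)
  qed
  show "?split ` block_perms (Suc R) \<subseteq> ?P"
  proof (rule image_subsetI)
    fix \<tau> assume \<tau>: "\<tau> \<in> block_perms (Suc R)"
    have p: "\<tau> permutes {1..U (Suc R)}" and le: "\<And>t r. \<tau> t \<le> U r \<longleftrightarrow> t \<le> U r"
      using block_permsD[OF \<tau>] by blast+
    have zero: "\<tau> 0 = 0"
      using permutes_not_in[OF p, of 0] by simp
    have pos: "\<tau> t \<ge> 1" if "t \<ge> 1" for t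
      using le[of t 0] that by auto
    let ?\<pi> = "\<lambda>t. if t \<le> U R then \<tau> t else t"
    let ?\<sigma> = "\<lambda>m. if m = 0 then 0 else \<tau> (U R + m) - U R"
    have "?\<pi> permutes {1..U R}"
    proof (rule permutes_finiteI)
      show "inj_on ?\<pi> {1..U R}"
        using permutes_inj[OF p] by (auto intro!: inj_onI simp: inj_eq)
    qed (use le pos zero in \<open>auto simp: not_le\<close>)
    moreover have "block_of (?\<pi> t) = block_of t" for t
      using block_permsD(2)[OF \<tau>] by simp
    ultimately have \<pi>: "?\<pi> \<in> block_perms R"
      by (simp add: block_perms_def)
    have gt: "U R < \<tau> (U R + m)" if "m > 0" for m
      using le[of "U R + m" R] that by simp
    have \<sigma>: "?\<sigma> permutes {1..u (Suc R)}"
    proof (rule permutes_finiteI)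
      show "inj_on ?\<sigma> {1..u (Suc R)}"
      proof (rule inj_onI)
        fix a b assume "a \<in> {1..u (Suc R)}" "b \<in> {1..u (Suc R)}" "?\<sigma> a = ?\<sigma> b"
        then have "\<tau> (U R + a) = \<tau> (U R + b)"
          using gt[of a] gt[of b] by auto
        then show "a = b"
          using permutes_inj[OF p] by (simp add: inj_eq)
      qed
      show "?\<sigma> m \<in> {1..u (Suc R)}" if "m \<in> {1..u (Suc R)}" for m
        using that gt[of m] le[of "U R + m" "Suc R"] by (auto simp: partial_sums_Suc)
      show "?\<sigma> m = m" if "m \<notin> {1..u (Suc R)}" for m
        using that permutes_not_in[OF p, of "U R + m"] by (auto simp: partial_sums_Suc)
    qed simp
    show "?split \<tau> \<in> ?P"
      using \<pi> \<sigma> by blast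
  qed
qed

text \<open>No descent crosses a block boundary, so each factor depends on the permutation of its
  own block. At the end of a block, \<open>\<sigma>\<close> fixing \<open>Suc (u r)\<close> records
  the same non-descent.\<close>

lemma sum_block_perms:
  fixes g :: "nat \<Rightarrow> bool \<Rightarrow> 'a::comm_semiring_1"
  shows "(\<Sum>\<pi>\<in>block_perms R. \<Prod>t=1..U R. g t (\<pi> (Suc t) < \<pi> t)) =
    (\<Prod>r=1..R. \<Sum>\<sigma> | \<sigma> permutes {1..u r}. \<Prod>m=1..u r. g (U (r - 1) + m) (\<sigma> (Suc m) < \<sigma> m))"
proof (induction R)
  case 0
  have "block_perms 0 = {id}"
    by (auto simp: block_perms_def)
  then show ?case
    by simp
next
  case (Suc R)
  let ?glue = "\<lambda>(\<pi>, \<sigma>) t. if t \<le> U R then \<pi> t else U R + \<sigma> (t - U R)"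
  let ?S = "{\<sigma>. \<sigma> permutes {1..u (Suc R)}}"
  let ?f = "\<lambda>\<pi>. \<Prod>t=1..U R. g t (\<pi> (Suc t) < \<pi> t)"
  let ?h = "\<lambda>\<sigma>. \<Prod>m=1..u (Suc R). g (U R + m) (\<sigma> (Suc m) < \<sigma> m)"
  have glue: "(\<Prod>t=1..U (Suc R). g t (?glue (\<pi>, \<sigma>) (Suc t) < ?glue (\<pi>, \<sigma>) t)) = ?f \<pi> * ?h \<sigma>"
    if \<pi>: "\<pi> \<in> block_perms R" and \<sigma>: "\<sigma> permutes {1..u (Suc R)}" for \<pi> \<sigma>
  proof -
    let ?\<tau> = "?glue (\<pi>, \<sigma>)"
    have p: "\<pi> permutes {1..U R}"
      using \<pi> by (simp add: block_perms_def)
    have "(\<Prod>t=1..U (Suc R). g t (?\<tau> (Suc t) < ?\<tau> t)) =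
        (\<Prod>t=1..U R. g t (?\<tau> (Suc t) < ?\<tau> t)) * (\<Prod>t=U R+1..U R+u (Suc R). g t (?\<tau> (Suc t) < ?\<tau> t))"
      unfolding partial_sums_Suc by (rule prod.ub_add_nat) simp
    also have "(\<Prod>t=1..U R. g t (?\<tau> (Suc t) < ?\<tau> t)) = ?f \<pi>"
    proof (rule prod.cong[OF refl])
      fix t assume t: "t \<in> {1..U R}"
      show "g t (?\<tau> (Suc t) < ?\<tau> t) = g t (\<pi> (Suc t) < \<pi> t)"
      \<comment> \<open>At the boundary the successor lies in the next block; both
        \<open>\<pi>\<close> and the glued permutation ascend there.\<close>
      proof (cases "t = U R")
        case True
        have "\<pi> t \<le> U R"
          using t permutes_in_image[OF p, of t] by auto
        moreover have "\<pi> (Suc t) = Suc t"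
          using True permutes_not_in[OF p, of "Suc t"] by simp
        ultimately show ?thesis
          using True by simp
      next
        case False
        then show ?thesis
          using t by simp
      qed
    qed
    also have "(\<Prod>t=U R+1..U R+u (Suc R). g t (?\<tau> (Suc t) < ?\<tau> t)) =
        (\<Prod>m=1..u (Suc R). g (m + U R) (?\<tau> (Suc (m + U R)) < ?\<tau> (m + U R)))"
      using prod.shift_bounds_cl_nat_ivl[of "\<lambda>t. g t (?\<tau> (Suc t) < ?\<tau> t)" 1 "U R" "u (Suc R)"]
      by (simp only: add.commute)
    also have "\<dots> = ?h \<sigma>"
      by (rule prod.cong[OF refl]) (auto simp: add.commute Suc_diff_le)
    finally show ?thesis .
  qed
  have "(\<Sum>\<tau>\<in>block_perms (Suc R). \<Prod>t=1..U (Suc R). g t (\<tau> (Suc t) < \<tau> t)) =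
      (\<Sum>p\<in>block_perms R \<times> ?S. \<Prod>t=1..U (Suc R). g t (?glue p (Suc t) < ?glue p t))"
    by (rule sum.reindex_bij_betw[OF bij_betw_block_perms_Suc, symmetric])
  also have "\<dots> = (\<Sum>(\<pi>, \<sigma>)\<in>block_perms R \<times> ?S. ?f \<pi> * ?h \<sigma>)"
    by (rule sum.cong[OF refl]) (use glue in auto)
  also have "\<dots> = sum ?f (block_perms R) * sum ?h ?S"
    by (simp add: sum_product sum.cartesian_product)
  finally show ?case
    unfolding Suc.IH by simp
qed

text \<open>Constancy of \<open>s\<close> on blocks makes the weight invariant under block
  permutations. \<open>s 1 \<ge> 1\<close> makes every partial sum positive, so the variable divides
  each \<open>y t\<close> and the geometric series converge.\<close>

theorem adic_sum_truncated:
  fixes c :: "part \<Rightarrow> 'a::comm_ring_1 fps" and s :: "nat \<Rightarrow> nat"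
  assumes s: "\<And>a b. block_of a = block_of b \<Longrightarrow> a \<noteq> 0 \<Longrightarrow> s a = s b" and s1: "s 1 \<ge> 1"
  defines "x \<equiv> \<lambda>t. c (Over t) * fps_X ^ partial_sums s t"
    and "y \<equiv> \<lambda>t. c (Plain t) * fps_X ^ partial_sums s t"
  shows "adic_sum (\<lambda>l. color_weight c l * fps_X ^ weight s l) (truncated_overpartitions R)
    ((\<Prod>r=1..R. euler_over (u r) (\<lambda>m. x (U (r - 1) + m))
        (\<lambda>m. if m = u r then 1 else y (U (r - 1) + m))) *
     (\<Prod>t=1..U R. fps_recip (1 - y t)))"
proof -
  let ?w = "\<lambda>l. color_weight c l * fps_X ^ weight s l"
  let ?G = "\<lambda>\<pi>. \<Prod>t=1..U R. (y t ^ of_bool (\<pi> (Suc t) < \<pi> t) + x t) * fps_recip (1 - y t)"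
  have y: "fps_X dvd y t" if "t \<in> {1..U R}" for t
  proof -
    have "s 1 \<le> partial_sums s t"
      unfolding partial_sums_def using that by (intro member_le_sum) auto
    then have "fps_X ^ 1 dvd (fps_X ^ partial_sums s t :: 'a fps)"
      using s1 by (intro le_imp_power_dvd) simp
    then show ?thesis
      by (simp add: y_def)
  qed
  have "adic_sum ?w (truncated_overpartitions R) (\<Sum>\<pi>\<in>block_perms R. ?G \<pi>)"
  proof (rule adic_sum_reindex[OF bij_betw_rearrange])
    show "adic_sum (\<lambda>(\<pi>, m). \<Prod>t=1..U R. step_weight (x t) (y t) (steps m t))
        (Sigma (block_perms R) (descent_compatible R)) (\<Sum>\<pi>\<in>block_perms R. ?G \<pi>)"
      using adic_sum_descent_compatible[of R y x, OF y]
      by (intro adic_sum_Sigma finite_block_perms) auto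
  next
    fix p assume p: "p \<in> Sigma (block_perms R) (descent_compatible R)"
    obtain \<pi> m where [simp]: "p = (\<pi>, m)"
      by (cases p)
    have \<pi>: "\<pi> permutes {1..U R}" "\<And>t. block_of (\<pi> t) = block_of t"
      and m: "m \<in> overpartitions (U R)"
      using p by (auto simp: block_perms_def descent_compatible_def)
    have inv: "inv \<pi> permutes {1..U R}"
      by (rule permutes_inv[OF \<pi>(1)])
    have "s (inv \<pi> t) = s t" for t
    proof (cases "t = 0")
      case True
      then show ?thesis
        using permutes_not_in[OF inv, of 0] by simp
    next
      case False
      have "block_of t = block_of (inv \<pi> t)"
        using \<pi>(2)[of "inv \<pi> t"] permutes_inverses(1)[OF \<pi>(1)] by simp
      then show ?thesis
        using s[of t "inv \<pi> t"] False by simp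
    qed
    then have "?w (\<lambda>t. m (inv \<pi> t)) = ?w m"
      using overpartitionsD(3)[OF m]
      by (simp add: color_weight_permute[OF inv] weight_permute[OF inv])
    then show "?w ((\<lambda>(\<pi>, m) t. m (inv \<pi> t)) p) =
        (case p of (\<pi>, m) \<Rightarrow> \<Prod>t=1..U R. step_weight (x t) (y t) (steps m t))"
      by (simp add: total_weight_overpartition[OF m] x_def y_def)
  qed
  also have "(\<Sum>\<pi>\<in>block_perms R. ?G \<pi>) =
      (\<Sum>\<pi>\<in>block_perms R. \<Prod>t=1..U R. y t ^ of_bool (\<pi> (Suc t) < \<pi> t) + x t) *
      (\<Prod>t=1..U R. fps_recip (1 - y t))"
    by (simp add: prod.distrib sum_distrib_right)
  also have "(\<Sum>\<pi>\<in>block_perms R. \<Prod>t=1..U R. y t ^ of_bool (\<pi> (Suc t) < \<pi> t) + x t) =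
      (\<Prod>r=1..R. \<Sum>\<sigma> | \<sigma> permutes {1..u r}. \<Prod>m=1..u r.
        y (U (r - 1) + m) ^ of_bool (\<sigma> (Suc m) < \<sigma> m) + x (U (r - 1) + m))"
    by (rule sum_block_perms[of "\<lambda>t b. y t ^ of_bool b + x t"])
  also have "\<dots> = (\<Prod>r=1..R. euler_over (u r) (\<lambda>m. x (U (r - 1) + m))
      (\<lambda>m. if m = u r then 1 else y (U (r - 1) + m)))"
    using u_pos by (intro prod.cong refl euler_over_eq_sum[symmetric]) auto
  finally show ?thesis .
qed

end

section \<open>The limit product\<close>

lemma euler_over_cong:
  assumes "n \<ge> 1" "\<And>m. m \<in> {1..n} \<Longrightarrow> x m = x' m" "\<And>m. m \<in> {1..n} \<Longrightarrow> y m = y' m"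
  shows "euler_over n x y = euler_over n x' y'"
  unfolding euler_over_def using assms
  by (intro arg_cong2[of _ _ _ _ "(*)"] arg_cong2[of _ _ _ _ "(+)"] sum.cong prod.cong) auto

lemma euler_over_1: "euler_over 1 x y = y 1 + x 1"
proof -
  have "{\<sigma>. \<sigma> permutes {1..1::nat}} = {id}"
    by (auto simp: permutes_sing)
  then show ?thesis
    by (simp add: euler_over_def)
qed

lemma permutes_no_descents_imp_id:
  assumes \<sigma>: "\<sigma> permutes {1..n}" and asc: "\<And>m. m \<in> {1..n} \<Longrightarrow> \<not> \<sigma> (Suc m) < \<sigma> m"
  shows "\<sigma> = id"
proof
  fix t
  have step: "\<sigma> r < \<sigma> (Suc r)" if "r \<in> {1..n}" for r
  proof -
    have "\<sigma> r \<noteq> \<sigma> (Suc r)"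
      using inj_eq[OF permutes_inj[OF \<sigma>], of r "Suc r"] by simp
    then show ?thesis
      using asc[OF that] by simp
  qed
  have mono: "\<sigma> a \<le> \<sigma> b" if "a \<in> {1..n}" "b \<in> {1..n}" "a \<le> b" for a b
  proof (cases "a = b")
    case False
    have "\<sigma> a < \<sigma> b"
    proof (rule less_if_ascents[of a b \<sigma>, rotated])
      fix r assume "a \<le> r" "r < b"
      then show "\<sigma> r < \<sigma> (Suc r)"
        using that by (intro step) auto
    qed (use that False in simp)
    then show ?thesis
      by simp
  qed simp
  have "\<sigma> t = t" if "t \<in> {1..n}"
    by (rule mono_rearrangement_eq[OF \<sigma>, of "\<lambda>t. t"]) (use mono that in auto)
  then show "\<sigma> t = id t"
    using permutes_not_in[OF \<sigma>] by (cases "t \<in> {1..n}") auto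
qed

text \<open>The identity contributes the product of the \<open>1 + x m\<close>; every other
  permutation has a descent and with it a factor \<open>y m + x m\<close> divisible by
  \<open>d\<close>. With \<open>d\<close> a power of the variable this makes the infinite product
  over rows converge.\<close>

lemma euler_over_dvd_diff_1:
  fixes x y :: "nat \<Rightarrow> 'a::comm_ring_1"
  assumes n: "n \<ge> 1" and x: "\<And>m. d dvd x m" and y: "\<And>m. d dvd y m"
  shows "d dvd euler_over n x (\<lambda>m. if m = n then 1 else y m) - 1"
proof -
  let ?f = "\<lambda>\<sigma>. \<Prod>m=1..n. y m ^ of_bool (\<sigma> (Suc m) < \<sigma> m) + x m"
  let ?S = "{\<sigma>. \<sigma> permutes {1..n}}"
  have "euler_over n x (\<lambda>m. if m = n then 1 else y m) = sum ?f ?S"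
    using n by (rule euler_over_eq_sum)
  also have "\<dots> = ?f id + sum ?f (?S - {id})"
  proof (rule sum.remove)
    show "id \<in> ?S"
      by (simp only: mem_Collect_eq permutes_id)
  qed (simp add: finite_permutations)
  finally have eq: "euler_over n x (\<lambda>m. if m = n then 1 else y m) - 1 =
      (?f id - (\<Prod>m=1..n. 1)) + sum ?f (?S - {id})"
    by (simp add: algebra_simps)
  have id: "d dvd ?f id - (\<Prod>m=1..n. 1)"
    using x by (intro dvd_diff_prod) auto
  have rest: "d dvd ?f \<sigma>" if \<sigma>: "\<sigma> \<in> ?S - {id}" for \<sigma>
  proof -
    obtain m where m: "m \<in> {1..n}" "\<sigma> (Suc m) < \<sigma> m"
      using permutes_no_descents_imp_id[of \<sigma> n] \<sigma> by auto
    then have "d dvd y m ^ of_bool (\<sigma> (Suc m) < \<sigma> m) + x m"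
      using x y by simp
    then show ?thesis
      using m(1) by (meson dvd_prodI dvd_trans finite_atLeastAtMost)
  qed
  show ?thesis
    unfolding eq by (intro dvd_add id dvd_sum rest)
qed

section \<open>The product side, arranged and truncated by rows\<close>

lemma prod_group_rows:
  fixes f :: "nat \<Rightarrow> 'a::comm_monoid_mult"
  shows "(\<Prod>t=1..J*K. f t) = (\<Prod>j<J. \<Prod>i=1..K. f (i + j * K))"
proof -
  have "(\<Prod>t=1..J*K. f t) = (\<Prod>t<J*K. f (Suc t))"
    by (simp add: prod.atLeast1_atMost_eq)
  also have "\<dots> = (\<Prod>j<J. \<Prod>t=j*K..<j*K+K. f (Suc t))"
    by (rule prod.nat_group[symmetric])
  also have "\<dots> = (\<Prod>j<J. \<Prod>i=1..K. f (i + j * K))"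
  proof (rule prod.cong[OF refl])
    fix j
    have "(\<Prod>t=j*K..<j*K+K. f (Suc t)) = (\<Prod>i<K. f (Suc (i + j * K)))"
      using prod.shift_bounds_nat_ivl[of "\<lambda>t. f (Suc t)" 0 "j * K" K]
      by (simp add: atLeast0LessThan add.commute)
    then show "(\<Prod>t=j*K..<j*K+K. f (Suc t)) = (\<Prod>i=1..K. f (i + j * K))"
      by (simp add: prod.atLeast1_atMost_eq)
  qed
  finally show ?thesis .
qed

lemma prod_split_first_and_blocks:
  fixes f :: "nat \<Rightarrow> 'a::comm_monoid_mult"
  shows "(\<Prod>m=1..k*n+1. f m) = f 1 * (\<Prod>i=1..k. \<Prod>m=2+(i-1)*n..1+i*n. f m)"
proof (induction k)
  case (Suc k)
  have "(\<Prod>m=1..Suc k*n+1. f m) = (\<Prod>m=1..(k*n+1)+n. f m)"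
    by (simp add: algebra_simps)
  also have "\<dots> = (\<Prod>m=1..k*n+1. f m) * (\<Prod>m=k*n+1+1..k*n+1+n. f m)"
    by (rule prod.ub_add_nat) simp
  also have "(\<Prod>m=k*n+1+1..k*n+1+n. f m) = (\<Prod>m=2+(Suc k-1)*n..1+Suc k*n. f m)"
    by (simp add: algebra_simps numeral_2_eq_2)
  also have "(\<Prod>m=1..k*n+1. f m) * (\<Prod>m=2+(Suc k-1)*n..1+Suc k*n. f m) =
      f 1 * (\<Prod>i=1..Suc k. \<Prod>m=2+(i-1)*n..1+i*n. f m)"
  proof -
    have "(\<Prod>i=1..Suc k. g i) = (\<Prod>i=1..k. g i) * g (Suc k)" for g :: "nat \<Rightarrow> 'a"
      by simp
    then show ?thesis
      unfolding Suc.IH by (simp only: mult.assoc)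
  qed
  finally show ?case .
qed simp

text \<open>Rows are counted from 0, so row \<open>j\<close> carries exponent \<open>Suc j\<close>.
  Entry \<open>m\<close> of the \<open>i\<close>-th long block stands in column
  \<open>m + 1 + (i - 1) * n\<close>: one place for the leading short block, the rest for the long
  blocks before it.\<close>

definition block_row :: "nat \<Rightarrow> (part \<Rightarrow> 'a::comm_ring_1 fps) \<Rightarrow> nat \<Rightarrow> nat \<Rightarrow> 'a fps" where
  "block_row n c i j = euler_over n
     (\<lambda>m. c (Over (m + 1 + (i - 1) * n)) * fps_X ^ Suc j)
     (\<lambda>m. if m = n then 1 else c (Plain (m + 1 + (i - 1) * n)) * fps_X ^ Suc j)"

text \<open>The right-hand side for arbitrary coefficients: with all \<open>c (Over d)\<close> equal
  to 0 it becomes the right-hand side for sequences without overlined parts.\<close>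

definition block_series :: "nat \<Rightarrow> nat \<Rightarrow> (part \<Rightarrow> 'a::comm_ring_1 fps) \<Rightarrow> 'a fps" where
  "block_series k n c =
     qpochhammer_inf (- c (Over 1) * fps_X) fps_X *
     fps_recip (qpochhammer_inf (c (Plain 1) * fps_X) fps_X) *
     (\<Prod>i=1..k. prodinf (block_row n c i) *
        fps_recip (\<Prod>m=2+(i-1)*n..1+i*n. qpochhammer_inf (c (Plain m) * fps_X) fps_X))"

lemma block_row_dvd:
  "n \<ge> 1 \<Longrightarrow> fps_X ^ Suc j dvd block_row n c i j - 1"
  unfolding block_row_def by (rule euler_over_dvd_diff_1) simp_all

lemma qpochhammer_inf_fps_X:
  fixes a :: "'a::comm_ring_1 fps"
  shows "fps_X ^ J dvd qpochhammer_inf (a * fps_X) fps_X - (\<Prod>j<J. 1 - a * fps_X ^ Suc j)"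
    and "qpochhammer_inf (a * fps_X) fps_X $ 0 = 1"
proof -
  have eq: "qpochhammer_inf (a * fps_X) fps_X = prodinf (\<lambda>j. 1 - a * fps_X ^ Suc j)"
    by (simp add: qpochhammer_inf_def mult.assoc)
  have P: "fps_X ^ Suc j dvd 1 - a * fps_X ^ Suc j - 1" for j
    by (simp add: dvd_mult del: power_Suc)
  show "fps_X ^ J dvd qpochhammer_inf (a * fps_X) fps_X - (\<Prod>j<J. 1 - a * fps_X ^ Suc j)"
    unfolding eq by (rule prodinf_fps_X_adic[OF P])
  show "qpochhammer_inf (a * fps_X) fps_X $ 0 = 1"
    unfolding eq by (rule prodinf_fps_nth_0[OF P])
qed

text \<open>Each infinite product is congruent to its first \<open>J\<close> factors.
  \<open>?T\<close> copies the shape of \<open>block_series\<close>, so the congruence follows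
  factor by factor; collecting \<open>?T\<close> by rows is then a reordering of finite
  products.\<close>

lemma block_series_truncation:
  fixes c :: "part \<Rightarrow> 'a::comm_ring_1 fps"
  assumes n: "n \<ge> 1"
  shows "fps_X ^ J dvd block_series k n c -
    (\<Prod>j<J. (1 + c (Over 1) * fps_X ^ Suc j) * (\<Prod>i=1..k. block_row n c i j) *
       (\<Prod>m=1..k*n+1. fps_recip (1 - c (Plain m) * fps_X ^ Suc j)))"
proof -
  define P where "P m = (\<Prod>j<J. 1 - c (Plain m) * fps_X ^ Suc j)" for m
  have P0: "P m $ 0 = 1" for m
    unfolding P_def by (rule fps_prod_nth_0_eq_1) simp
  let ?T = "(\<Prod>j<J. 1 - (- c (Over 1)) * fps_X ^ Suc j) * fps_recip (P 1) *
      (\<Prod>i=1..k. (\<Prod>j<J. block_row n c i j) * fps_recip (\<Prod>m=2+(i-1)*n..1+i*n. P m))"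
  have qp: "fps_X ^ J dvd qpochhammer_inf (c (Plain m) * fps_X) fps_X - P m" for m
    unfolding P_def by (rule qpochhammer_inf_fps_X)
  have "fps_X ^ J dvd block_series k n c - ?T"
    unfolding block_series_def
    by (intro dvd_diff_mult dvd_diff_prod dvd_diff_fps_recip prodinf_fps_X_adic block_row_dvd n
          fps_prod_nth_0_eq_1 P0 qp qpochhammer_inf_fps_X)
  moreover have "?T = (\<Prod>j<J. (1 + c (Over 1) * fps_X ^ Suc j) * (\<Prod>i=1..k. block_row n c i j) *
       (\<Prod>m=1..k*n+1. fps_recip (1 - c (Plain m) * fps_X ^ Suc j)))"
  proof -
    have recip_P: "fps_recip (P m) = (\<Prod>j<J. fps_recip (1 - c (Plain m) * fps_X ^ Suc j))" for m
      unfolding P_def by (rule fps_recip_prod) simp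
    have "fps_recip (P 1) * (\<Prod>i=1..k. fps_recip (\<Prod>m=2+(i-1)*n..1+i*n. P m)) =
        (\<Prod>m=1..k*n+1. fps_recip (P m))"
      by (simp only: fps_recip_prod[OF P0] prod_split_first_and_blocks)
    also have "\<dots> = (\<Prod>j<J. \<Prod>m=1..k*n+1. fps_recip (1 - c (Plain m) * fps_X ^ Suc j))"
      unfolding recip_P by (rule prod.swap)
    finally have recips: "fps_recip (P 1) *
        (\<Prod>i=1..k. fps_recip (\<Prod>m=2+(i-1)*n..1+i*n. P m)) =
        (\<Prod>j<J. \<Prod>m=1..k*n+1. fps_recip (1 - c (Plain m) * fps_X ^ Suc j))" .
    have "?T = (\<Prod>j<J. 1 + c (Over 1) * fps_X ^ Suc j) * (\<Prod>i=1..k. \<Prod>j<J. block_row n c i j) *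
        (fps_recip (P 1) * (\<Prod>i=1..k. fps_recip (\<Prod>m=2+(i-1)*n..1+i*n. P m)))"
      by (simp add: prod.distrib mult_ac del: power_Suc)
    also have "\<dots> = (\<Prod>j<J. (1 + c (Over 1) * fps_X ^ Suc j) * (\<Prod>i=1..k. block_row n c i j) *
         (\<Prod>m=1..k*n+1. fps_recip (1 - c (Plain m) * fps_X ^ Suc j)))"
      unfolding recips prod.swap[of _ "{..<J}" "{1..k}"] by (simp only: prod.distrib)
    finally show ?thesis .
  qed
  ultimately show ?thesis
    by simp
qed

text \<open>The number of indices up to \<open>t\<close> that are congruent to 1 is the ceiling of
  \<open>t / N\<close>, here as a rounded-down quotient.\<close>

lemma partial_sums_indicator_cong_1:
  fixes N :: nat
  assumes N: "N \<ge> 1" and s: "\<And>i. i \<ge> 1 \<Longrightarrow> s i = (if [i = 1] (mod N) then 1 else 0)"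
  shows "partial_sums s t = (t + (N - 1)) div N"
proof (induction t)
  case 0
  then show ?case
    using N by simp
next
  case (Suc t)
  have "[Suc t = 1] (mod N) \<longleftrightarrow> N dvd t"
    using cong_add_rcancel_0_nat[of t 1 N] by (simp add: cong_0_iff)
  also have "\<dots> \<longleftrightarrow> Suc (t + (N - 1)) mod N = 0"
    using N by (simp add: mod_eq_0_iff_dvd)
  finally have "s (Suc t) = (if Suc (t + (N - 1)) mod N = 0 then 1 else 0)"
    using s[of "Suc t"] by simp
  then show ?case
    by (simp add: partial_sums_Suc Suc.IH div_Suc)
qed

text \<open>One period is a row: a block of length 1 and then \<open>k\<close> blocks of length
  \<open>n\<close>, hence \<open>k + 1\<close> blocks and \<open>k * n + 1\<close> positions. Rows
  are numbered from 0.\<close>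

locale period_blocks = blocks +
  fixes k n :: nat and s :: "nat \<Rightarrow> nat"
  assumes n_pos: "n \<ge> 1"
    and u_first: "u (1 + j * (k + 1)) = 1"
    and u_rest: "2 \<le> i \<Longrightarrow> i \<le> k + 1 \<Longrightarrow> u (i + j * (k + 1)) = n"
    and s: "i \<ge> 1 \<Longrightarrow> s i = (if [i = 1] (mod k * n + 1) then 1 else 0)"
begin

lemma U_row: "i \<le> k \<Longrightarrow> U (i + 1 + j * (k + 1)) = U (j * (k + 1)) + 1 + i * n"
proof (induction i)
  case 0
  then show ?case
    using u_first[of j] by (simp add: partial_sums_Suc)
next
  case (Suc i)
  then show ?case
    using u_rest[of "Suc i + 1" j] by (simp add: partial_sums_Suc)
qed

lemma U_rows: "U (j * (k + 1)) = j * (k * n + 1)"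
proof (induction j)
  case (Suc j)
  have "U (Suc j * (k + 1)) = U (k + 1 + j * (k + 1))"
    by (simp add: algebra_simps)
  then show ?case
    using U_row[of k j] Suc by (simp add: algebra_simps)
qed simp

lemma partial_sums_s:
  assumes "1 \<le> r" "r \<le> k * n + 1"
  shows "partial_sums s (r + j * (k * n + 1)) = Suc j"
proof -
  have "partial_sums s (r + j * (k * n + 1)) = (r + j * (k * n + 1) + (k * n + 1 - 1)) div (k * n + 1)"
    by (rule partial_sums_indicator_cong_1) (use s in auto)
  also have "r + j * (k * n + 1) + (k * n + 1 - 1) = (r - 1) + Suc j * (k * n + 1)"
    using assms by simp
  also have "\<dots> div (k * n + 1) = Suc j"
    using assms by (subst div_mult_self1) auto
  finally show ?thesis .
qed

lemma s_row_start: "s (j * (k * n + 1) + 1) = 1"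
proof -
  have "[j * (k * n + 1) + 1 = 1] (mod k * n + 1)"
    by (simp only: cong_def mod_mult_self3)
  then show ?thesis
    using s[of "j * (k * n + 1) + 1"] by simp
qed

lemma block_of_row_start_iff: "block_of a = 1 + j * (k + 1) \<longleftrightarrow> a = j * (k * n + 1) + 1"
  using block_of_eq_Suc_iff[of a "j * (k + 1)"] U_row[of 0 j] U_rows[of j] by auto

text \<open>\<open>s\<close> is 1 only at row starts, and each of these is a block by
  itself.\<close>

lemma s_const_on_blocks:
  assumes "block_of a = block_of b" "a \<noteq> 0"
  shows "s a = s b"
proof -
  have eq: "s a = s b" if ab: "block_of a = block_of b" "a \<noteq> 0" and a: "[a = 1] (mod k * n + 1)" for a b
  proof -
    obtain j where "a = j * (k * n + 1) + 1"
      using a ab(2) cong_to_1'_nat[of a "k * n + 1"] by auto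
    then have "block_of b = 1 + j * (k + 1)"
      using ab block_of_row_start_iff by metis
    then have "b = a"
      using \<open>a = _\<close> block_of_row_start_iff by metis
    then show ?thesis
      by simp
  qed
  have "b \<noteq> 0"
    using assms block_of_pos_iff[of a] block_of_pos_iff[of b] by simp
  then show ?thesis
    using eq[of a b] eq[of b a] assms s[of a] s[of b]
    by (cases "[a = 1] (mod k * n + 1)"; cases "[b = 1] (mod k * n + 1)") auto
qed

text \<open>A nonzero part beyond the first \<open>J\<close> rows bounds from below the parts at the
  \<open>J\<close> row starts, all of which lie in earlier blocks; each of these adds at least 1 to
  the weight.\<close>

lemma weight_ge_rows:
  assumes l: "l \<in> block_overpartitions u - truncated_overpartitions (J * (k + 1))"
  shows "J \<le> weight s l"
proof -
  have seq: "l \<in> parts_seqs"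
    and blk: "\<And>a b. a \<ge> 1 \<Longrightarrow> block_of a < block_of b \<Longrightarrow> l b \<le> l a"
    using l by (auto simp: block_overpartitions_iff)
  obtain t where t: "t > U (J * (k + 1))" "l t \<noteq> Plain 0"
    using l by (auto simp: truncated_overpartitions_def)
  have "part_size (l t) \<noteq> 0"
    using t(2) parts_seqsD(2)[OF seq, of t] by (cases "l t") auto
  moreover have "part_size (l t) \<le> part_size (l (j * (k * n + 1) + 1))" if "j < J" for j
  proof (intro less_eq_part_imp_size blk)
    have "block_of (j * (k * n + 1) + 1) = 1 + j * (k + 1)"
      by (simp only: block_of_row_start_iff)
    also have "\<dots> \<le> Suc j * (k + 1)"
      by simp
    also have "\<dots> \<le> J * (k + 1)"
      using that by (intro mult_le_mono1) simp
    also have "\<dots> < block_of t"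
      using t(1) by (simp only: block_of_less_iff)
    finally show "block_of (j * (k * n + 1) + 1) < block_of t" .
  qed simp
  ultimately have pos: "part_size (l (j * (k * n + 1) + 1)) \<ge> 1" if "j < J" for j
    using that by (metis One_nat_def Suc_leI le_zero_eq not_gr_zero)
  let ?A = "(\<lambda>j. j * (k * n + 1) + 1) ` {..<J}"
  have "inj_on (\<lambda>j. j * (k * n + 1) + 1) {..<J}"
    by (rule inj_onI) (simp del: mult_Suc_right)
  then have "J = (\<Sum>i\<in>?A. 1)"
    by (simp add: card_image)
  also have "\<dots> \<le> (\<Sum>i\<in>?A. part_size (l i) * s i)"
    using pos by (intro sum_mono) (auto simp: s_row_start simp del: One_nat_def add_Suc_right mult_Suc_right)
  also have "\<dots> \<le> weight s l"
    unfolding weight_def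
  proof (rule sum_mono2)
    show "finite {i. i \<ge> 1 \<and> l i \<noteq> Plain 0}"
      using parts_seqsD(3)[OF seq] by (rule finite_subset[rotated]) auto
    show "?A \<subseteq> {i. i \<ge> 1 \<and> l i \<noteq> Plain 0}"
      using pos by fastforce
  qed simp
  finally show ?thesis .
qed

text \<open>The same \<open>J\<close> truncates the sequences after \<open>J\<close> rows and the
  infinite products after \<open>J\<close> factors. By periodicity of the colors, row
  \<open>j\<close> of the truncated sum is factor \<open>j\<close> of the product.\<close>

theorem adic_sum_block_overpartitions:
  fixes c :: "part \<Rightarrow> 'a::comm_ring_1 fps"
  assumes per_plain: "\<And>i j. 1 \<le> j \<Longrightarrow> j \<le> k * n + 1 \<Longrightarrow> c (Plain (j + i * (k * n + 1))) = c (Plain j)"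
    and per_over: "\<And>i j. 1 \<le> j \<Longrightarrow> j \<le> k * n + 1 \<Longrightarrow> c (Over (j + i * (k * n + 1))) = c (Over j)"
  shows "adic_sum (\<lambda>l. color_weight c l * fps_X ^ weight s l) (block_overpartitions u)
    (block_series k n c)"
proof (rule adic_sum_approx)
  fix J
  let ?w = "\<lambda>l. color_weight c l * fps_X ^ weight s l"
  define N where "N = k * n + 1"
  define x where "x t = c (Over t) * fps_X ^ partial_sums s t" for t
  define y where "y t = c (Plain t) * fps_X ^ partial_sums s t" for t
  define e where "e r = euler_over (u r) (\<lambda>m. x (U (r - 1) + m))
      (\<lambda>m. if m = u r then 1 else y (U (r - 1) + m))" for r
  have x: "x (r + j * N) = c (Over r) * fps_X ^ Suc j" if "1 \<le> r" "r \<le> N" for r j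
    using that partial_sums_s per_over by (simp add: x_def N_def)
  have y: "y (r + j * N) = c (Plain r) * fps_X ^ Suc j" if "1 \<le> r" "r \<le> N" for r j
    using that partial_sums_s per_plain by (simp add: y_def N_def)
  have "s 1 \<ge> 1"
    using s_row_start[of 0] by simp
  then have sum: "adic_sum ?w (truncated_overpartitions (J * (k + 1)))
      ((\<Prod>r=1..J*(k+1). e r) * (\<Prod>t=1..U (J*(k+1)). fps_recip (1 - y t)))"
    unfolding e_def x_def y_def using s_const_on_blocks by (intro adic_sum_truncated)
  have "(\<Prod>t=1..U (J*(k+1)). fps_recip (1 - y t)) =
      (\<Prod>j<J. \<Prod>m=1..N. fps_recip (1 - y (m + j * N)))"
    unfolding U_rows N_def[symmetric] by (rule prod_group_rows)
  also have "\<dots> = (\<Prod>j<J. \<Prod>m=1..N. fps_recip (1 - c (Plain m) * fps_X ^ Suc j))"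
    by (intro prod.cong refl) (simp only: y atLeastAtMost_iff)
  finally have denominators: "(\<Prod>t=1..U (J*(k+1)). fps_recip (1 - y t)) = \<dots>" .
  have e_first: "e (1 + j * (k + 1)) = 1 + c (Over 1) * fps_X ^ Suc j" for j
  proof -
    have Uj: "U (1 + j * (k + 1) - 1) = j * N"
      by (simp only: add_diff_cancel_left' U_rows N_def)
    have "e (1 + j * (k + 1)) = 1 + x (1 + j * N)"
      unfolding e_def u_first euler_over_1 Uj by (simp add: add.commute)
    also have "x (1 + j * N) = c (Over 1) * fps_X ^ Suc j"
      by (rule x) (simp_all add: N_def)
    finally show ?thesis .
  qed
  have e_rest: "e (i + 1 + j * (k + 1)) = block_row n c i j" if i: "i \<in> {1..k}" for i j
  proof -
    have ui: "u (i + 1 + j * (k + 1)) = n"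
      using i by (intro u_rest) auto
    have "U (i + 1 + j * (k + 1) - 1) = U (i - 1 + 1 + j * (k + 1))"
      using i by simp
    also have "\<dots> = j * N + 1 + (i - 1) * n"
    proof -
      have "i - 1 \<le> k"
        using i by auto
      then show ?thesis
        by (simp only: U_row U_rows N_def)
    qed
    finally have Ui: "U (i + 1 + j * (k + 1) - 1) + m = (m + 1 + (i - 1) * n) + j * N" for m
      by simp
    have bound: "1 \<le> m + 1 + (i - 1) * n" "m + 1 + (i - 1) * n \<le> N" if "m \<in> {1..n}" for m
    proof -
      have "m + (i - 1) * n \<le> Suc (i - 1) * n"
        using that by simp
      also have "\<dots> \<le> k * n"
        using i by (intro mult_le_mono1) auto
      finally show "m + 1 + (i - 1) * n \<le> N"
        by (simp add: N_def)
    qed simp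
    show ?thesis
      unfolding e_def block_row_def ui Ui
      by (rule euler_over_cong[OF n_pos]) (simp_all only: x y bound)
  qed
  have "(\<Prod>r=1..J*(k+1). e r) = (\<Prod>j<J. \<Prod>i=1..k+1. e (i + j * (k + 1)))"
    by (rule prod_group_rows)
  also have "\<dots> = (\<Prod>j<J. (1 + c (Over 1) * fps_X ^ Suc j) * (\<Prod>i=1..k. block_row n c i j))"
  proof (rule prod.cong[OF refl])
    fix j
    have "(\<Prod>i=1..k+1. e (i + j * (k + 1))) =
        e (1 + j * (k + 1)) * (\<Prod>i=1+1..k+1. e (i + j * (k + 1)))"
      by (subst prod.atLeast_Suc_atMost) auto
    also have "(\<Prod>i=1+1..k+1. e (i + j * (k + 1))) = (\<Prod>i=1..k. e (i + 1 + j * (k + 1)))"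
      by (rule prod.shift_bounds_cl_nat_ivl)
    also have "\<dots> = (\<Prod>i=1..k. block_row n c i j)"
      by (intro prod.cong refl e_rest)
    finally show "(\<Prod>i=1..k+1. e (i + j * (k + 1))) =
        (1 + c (Over 1) * fps_X ^ Suc j) * (\<Prod>i=1..k. block_row n c i j)"
      unfolding e_first .
  qed
  finally have numerators: "(\<Prod>r=1..J*(k+1). e r) = \<dots>" .
  have "fps_X ^ J dvd block_series k n c -
      (\<Prod>r=1..J*(k+1). e r) * (\<Prod>t=1..U (J*(k+1)). fps_recip (1 - y t))"
    using block_series_truncation[OF n_pos, of J k c]
    unfolding numerators denominators N_def prod.distrib .
  moreover have "fps_X ^ J dvd ?w l"
    if "l \<in> block_overpartitions u - truncated_overpartitions (J * (k + 1))" for l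
    using weight_ge_rows[OF that] by (intro dvd_mult le_imp_power_dvd)
  moreover have "truncated_overpartitions (J * (k + 1)) \<subseteq> block_overpartitions u"
    by (auto simp: truncated_overpartitions_def)
  ultimately show "\<exists>B\<subseteq>block_overpartitions u. \<exists>T. adic_sum ?w B T \<and>
      fps_X ^ J dvd block_series k n c - T \<and> (\<forall>l\<in>block_overpartitions u - B. fps_X ^ J dvd ?w l)"
    using sum by blast
qed

end

section \<open>Partitions without overlined parts\<close>

text \<open>If \<open>Over d\<close> occurs, then \<open>d\<close> is among the indices of the color
  product and the conjugate entry at \<open>d\<close> is overlined, so one factor vanishes.\<close>

lemma color_weight_eq_0:
  fixes c :: "part \<Rightarrow> 'a::comm_semiring_1"
  assumes l: "l \<in> parts_seqs" and i: "i \<ge> 1" "overlined (l i)" and c: "\<And>d. c (Over d) = 0"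
  shows "color_weight c l = 0"
proof -
  obtain d where d: "l i = Over d"
    using i by (cases "l i") auto
  then have "d > 0"
    using parts_seqsD(2)[OF l, of i] by (cases d) auto
  have "l i \<le> max_part l"
    unfolding max_part_def using finite_range_parts_seq[OF l] i by (intro Max_ge) auto
  with d \<open>d > 0\<close> have "d \<in> {i. Plain 0 < Over i \<and> Over i \<le> max_part l}"
    by (auto simp: less_part_def)
  moreover have "finite {i. Plain 0 < Over i \<and> Over i \<le> max_part l}"
    by (rule finite_subset[of _ "{..part_size (max_part l)}"]) (auto simp: Over_le_iff)
  moreover have "c (conjugate l d) = 0"
    using i d c by (auto simp: conjugate_def)
  ultimately show ?thesis
    unfolding color_weight_def by (intro prod_zero) blast+
qed

lemma color_weight_cong_plain:
  assumes "\<And>i. i \<ge> 1 \<Longrightarrow> \<not> overlined (l i)" "\<And>d. c (Plain d) = c' (Plain d)"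
  shows "color_weight c l = color_weight c' l"
proof -
  have "(\<exists>j\<ge>1. l j = Over i) \<longleftrightarrow> False" for i
    using assms(1) by fastforce
  then show ?thesis
    by (simp only: color_weight_def conjugate_def if_False assms(2))
qed

lemma euler_over_0_eq_euler_plain:
  fixes y :: "nat \<Rightarrow> 'a::comm_semiring_1"
  assumes "n \<ge> 1"
  shows "euler_over n (\<lambda>_. 0) (\<lambda>m. if m = n then 1 else y m) = euler_plain n y"
  unfolding euler_over_def euler_plain_def using assms
  by (auto intro!: sum.cong prod.cong)

theorem corollary1p25:
  fixes k n :: nat and u s :: "nat \<Rightarrow> nat" and c :: "part \<Rightarrow> color_poly"
    and q :: "color_poly fps" and C :: "part \<Rightarrow> color_poly fps"
  assumes "k \<ge> 1" and "n \<ge> 1"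
    and "\<And>i. u (1 + i * (k + 1)) = 1"
    and "\<And>i j. 2 \<le> j \<Longrightarrow> j \<le> k + 1 \<Longrightarrow> u (j + i * (k + 1)) = n"
    and "\<And>i. i \<ge> 1 \<Longrightarrow> s i = (if [i = 1] (mod (k * n + 1)) then 1 else 0)"
    and "\<And>j. 1 \<le> j \<Longrightarrow> j \<le> n * k + 1 \<Longrightarrow> c (Plain j) = indet (Plain j)"
    and "\<And>j. 1 \<le> j \<Longrightarrow> j \<le> n * k + 1 \<Longrightarrow> c (Over j) = indet (Over j)"
    and "\<And>i j. 1 \<le> j \<Longrightarrow> j \<le> n * k + 1 \<Longrightarrow> c (Plain (j + i * (n * k + 1))) = c (Plain j)"
    and "\<And>i j. 1 \<le> j \<Longrightarrow> j \<le> n * k + 1 \<Longrightarrow> c (Over (j + i * (n * k + 1))) = c (Over j)"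
    and "q = fps_X" and "\<And>v. C v = fps_const (c v)"
  shows "((\<lambda>l. color_weight C l * q ^ weight s l) has_sum
      qpochhammer_inf (- C (Over 1) * q) q * fps_recip (qpochhammer_inf (C (Plain 1) * q) q) *
      (\<Prod>i=1..k.
        prodinf (\<lambda>j. euler_over n
          (\<lambda>m. C (Over (m + 1 + (i - 1) * n)) * q ^ Suc j)
          (\<lambda>m. if m = n then 1 else C (Plain (m + 1 + (i - 1) * n)) * q ^ Suc j)) *
        fps_recip (\<Prod>m = 2 + (i - 1) * n..1 + i * n. qpochhammer_inf (C (Plain m) * q) q)))
      (block_overpartitions u) \<and>
    ((\<lambda>l. color_weight C l * q ^ weight s l) has_sum
      fps_recip (qpochhammer_inf (C (Plain 1) * q) q) *
      (\<Prod>i=1..k.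
        prodinf (\<lambda>j. euler_plain n (\<lambda>m. C (Plain (m + 1 + (i - 1) * n)) * q ^ Suc j)) *
        fps_recip (\<Prod>m = 2 + (i - 1) * n..1 + i * n. qpochhammer_inf (C (Plain m) * q) q)))
      (block_partitions u)"
proof -
  note n = \<open>n \<ge> 1\<close> and q = \<open>q = fps_X\<close>
  have u_pos: "u r \<ge> 1" if r: "r \<ge> 1" for r
  proof -
    \<comment> \<open>Euclidean division of \<open>r - 1\<close>: \<open>j\<close> is the row of
      block \<open>r\<close>, and \<open>i\<close> its number within the row, from 1 to
      \<open>k + 1\<close>.\<close>
    define i j where "i = (r - 1) mod (k + 1) + 1" and "j = (r - 1) div (k + 1)"
    have "r = i + j * (k + 1)"
      using r div_mult_mod_eq[of "r - 1" "k + 1"] by (simp add: i_def j_def)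
    moreover have "1 \<le> i" "i \<le> k + 1"
      using mod_less_divisor[of "k + 1" "r - 1"] by (auto simp: i_def)
    ultimately show ?thesis
      using assms(3)[of j] assms(4)[of i j] n by (cases "i = 1") auto
  qed
  interpret period_blocks u k n s
    by unfold_locales (use u_pos assms(2-5) in blast)+
  note periodic = assms(8,9)[unfolded mult.commute[of n k]]
  have "adic_sum (\<lambda>l. color_weight C l * fps_X ^ weight s l) (block_overpartitions u)
      (block_series k n C)"
    by (rule adic_sum_block_overpartitions) (simp_all only: assms(11) periodic)
  then have over: "((\<lambda>l. color_weight C l * q ^ weight s l) has_sum block_series k n C)
      (block_overpartitions u)"
    unfolding q by (rule adic_sum_imp_has_sum)
  \<comment> \<open>With the overlined colors killed, the sum over all block overpartitions
    collapses to those without overlined parts, on which \<open>C0\<close> and \<open>C\<close> give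
    the same weight.\<close>
  define C0 where "C0 p = (if overlined p then 0 else C p)" for p
  have C0: "C0 (Over d) = 0" "C0 (Plain d) = C (Plain d)" for d
    by (simp_all add: C0_def)
  have "adic_sum (\<lambda>l. color_weight C0 l * fps_X ^ weight s l) (block_overpartitions u)
      (block_series k n C0)"
    by (rule adic_sum_block_overpartitions) (simp_all only: C0 assms(11) periodic)
  then have "((\<lambda>l. color_weight C0 l * q ^ weight s l) has_sum block_series k n C0)
      (block_overpartitions u)"
    unfolding q by (rule adic_sum_imp_has_sum)
  also have "?this \<longleftrightarrow> ((\<lambda>l. color_weight C l * q ^ weight s l) has_sum block_series k n C0)
      (block_partitions u)"
  proof (rule has_sum_cong_neutral)
    fix l assume l: "l \<in> block_overpartitions u - block_partitions u"
    then obtain i where "i \<ge> 1" "overlined (l i)"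
      by (auto simp: block_partitions_def)
    moreover have "l \<in> parts_seqs"
      using l by (simp add: block_overpartitions_def)
    ultimately show "color_weight C0 l * q ^ weight s l = 0"
      using color_weight_eq_0[of l i C0] C0(1) by simp
  next
    fix l assume "l \<in> block_overpartitions u \<inter> block_partitions u"
    then have "color_weight C0 l = color_weight C l"
      using C0(2) by (intro color_weight_cong_plain) (auto simp: block_partitions_def)
    then show "color_weight C0 l * q ^ weight s l = color_weight C l * q ^ weight s l"
      by simp
  qed (auto simp: block_partitions_def)
  finally have plain: "((\<lambda>l. color_weight C l * q ^ weight s l) has_sum block_series k n C0)
      (block_partitions u)" .
  have row: "block_row n C0 i = (\<lambda>j. euler_plain n (\<lambda>m. C (Plain (m + 1 + (i - 1) * n)) * q ^ Suc j))"
    for i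
    unfolding block_row_def C0 mult_zero_left euler_over_0_eq_euler_plain[OF n] q ..
  \<comment> \<open>This is the numerator product in front once \<open>C0 (Over 1)\<close> is 0: all
    its truncations equal 1, hence so does every coefficient comparison with 1.\<close>
  have "qpochhammer_inf (0 * fps_X) fps_X = (1 :: color_poly fps)"
  proof (rule fps_ext)
    fix i
    show "qpochhammer_inf (0 * fps_X) fps_X $ i = (1 :: color_poly fps) $ i"
      using qpochhammer_inf_fps_X(1)[of "Suc i" "0 :: color_poly fps"]
      unfolding fps_X_power_dvd_diff_iff by auto
  qed
  then have "block_series k n C0 = fps_recip (qpochhammer_inf (C (Plain 1) * q) q) *
      (\<Prod>i=1..k.
        prodinf (\<lambda>j. euler_plain n (\<lambda>m. C (Plain (m + 1 + (i - 1) * n)) * q ^ Suc j)) *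
        fps_recip (\<Prod>m = 2 + (i - 1) * n..1 + i * n. qpochhammer_inf (C (Plain m) * q) q))"
    unfolding block_series_def row C0 q[symmetric] by simp
  with plain over show ?thesis
    unfolding block_series_def block_row_def q by simp
qed

end
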